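(* There is a constant $c_d<\infty$ depending only on $d$ such that the following holds. Let $x\in\mathbb R^d$, $\mathbf n\in S^{d-1}$, $\mathcal S\in\mathbb S_{\mathbf n}$, $L,H\ge 2\sqrt d$ and $\mathcal R=\mathcal R_{x,L,H}(\mathcal S,\mathbf n)$. The surface tension $\tau^J_{\mathcal R}$ is a non-decreasing function of $J$ (for the product order) and of $\beta\geq 0$. It is a non-increasing function of $H$ (on $H\ge 2\sqrt d$, with $x,L,\mathcal S,\mathbf n,J,\beta$ fixed). With probability one under $\mathbb P$, $$0\le \tau^{\min}_{\mathcal R}\le \tau^J_{\mathcal R}\le \tau^{\max}_{\mathcal R}\le c_d\,\beta J^{\max}.$$
   Context: Fix $d\ge 2$, $q\ge 1$, $\beta\ge 0$. For $x,y\in\mathbb Z^d$ write $x\sim y$ if $\|x-y\|_2=1$; for $\Lambda\subset\mathbb Z^d$ let $E(\Lambda)=\{\{x,y\}:x,y\in\Lambda,\ x\sim y\}$. The couplings $J=(J_e)_{e\in E(\mathbb Z^d)}$ are i.i.d. with values in $[0,1]$ under the product measure $\mathbb P$ (expectation $\mathbb E$). $J^{\min}=\inf\{\lambda\ge0:\mathbb P(J_e<\lambda)>0\}$, $J^{\max}=\sup\{\lambda\ge0:\mathbb P(J_e>\lambda)>0\}$. Random cluster model: for finite $E\subset E(\mathbb Z^d)$, boundary condition $\pi\in\{0,1\}^{E^c}$ and $\omega\in\{0,1\}^E$, $\Phi^{J,\pi,q}_{E,\beta}(\{\omega\})=\frac1Z\prod_{e\in E}p_e^{\omega_e}(1-p_e)^{1-\omega_e}\,q^{C^\pi_E(\omega)}$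 with $p_e=1-e^{-\beta J_e}$, where $C^\pi_E(\omega)$ is the number of clusters of the set of vertices touched by $E$ when connections use the open edges of $\omega$ in $E$ and of $\pi$ outside $E$, and $Z$ is the normalizing constant. The boundary condition $w$ (wired) is $\pi\equiv1$. Geometry: $S^{d-1}$ is the Euclidean unit sphere. For $\mathbf n\in S^{d-1}$, $\mathbb S_{\mathbf n}$ is the set of the $(d-1)$-dimensional unit cubes $\{\sum_{k=1}^{d-1}t_k\mathbf u_k: t_k\in[-\frac12,\frac12]\}$ with $(\mathbf u_1,\dots,\mathbf u_{d-1},\mathbf n)$ an orthonormal basis of $\mathbb R^d$. $\mathcal R_{x,L,H}(\mathcal S,\mathbf n)=x+L\mathcal S+[-H,H]\mathbf n$. For such $\mathcal R$, $\hat{\mathcal R}$ is the set of points of $\mathbb Z^d$ in the interior of $\mathcal R$; $\partial\hat{\mathcal R}=\{y\in\hat{\mathcal R}:\exists z\in\mathbb Z^d\setminus\hat{\mathcal R},\ z\sim y\}$; $\partial^+\hat{\mathcal R}=\{y\in\partial\hat{\mathcal R}:(y-x)\cdot\mathbf n\ge0\}$, $\partial^-\hat{\mathcal R}=\{y\in\partial\hat{\mathcal R}:(y-x)\cdot\mathbf n<0\}$. $\Phi^{J,w}_{\mathcal R}$ is $\Phi^{J,w,q}_{E(\hat{\mathcal R}),\beta}$. Surface tension: $\mathcal D_{\mathcal R}$ is the event that no $\omega$-open path in $E(\hat{\mathcal R})$ joins $\partial^+\hat{\mathcal R}$ to $\partial^-\hat{\mathcal R}$, and $\tau^J_{\mathcal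 R}=-\frac1{L^{d-1}}\log\Phi^{J,w}_{\mathcal R}(\mathcal D_{\mathcal R})$. $\tau^{\min}_{\mathcal R}$ (resp. $\tau^{\max}_{\mathcal R}$) is the value of $\tau^J_{\mathcal R}$ for constant couplings $J\equiv J^{\min}$ (resp. $J\equiv J^{\max}$). *)

theory Defs
  imports "HOL-Probability.Probability"
begin

text \<open>
  Throughout, the dimension is \<open>d = CARD('d)\<close>, and the vertices of the lattice are represented as the
  points of \<open>real ^ 'd\<close> with integer coordinates.
\<close>

definition int_lattice :: "(real ^ 'd) set" where
  "int_lattice = {x. \<forall>i. x $ i \<in> \<int>}"

definition edges_in :: "(real ^ 'd) set \<Rightarrow> (real ^ 'd) set set" where
  "edges_in V = {{x, y} | x y. x \<in> V \<and> y \<in> V \<and> norm (x - y) = 1}"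

abbreviation lattice_edges :: "(real ^ 'd) set set" where
  "lattice_edges \<equiv> edges_in int_lattice"


text \<open>
  The measure \<open>\<mu>\<close> is the common law of the couplings \<open>J e\<close>, so that the probability of \<open>J e < l\<close>
  is \<open>measure \<mu> {j. j < l}\<close>, for every edge \<open>e\<close>.
\<close>

definition coupling_law :: "real measure \<Rightarrow> bool" where
  "coupling_law \<mu> \<longleftrightarrow> prob_space \<mu> \<and> sets \<mu> = sets borel \<and> (AE j in \<mu>. j \<in> {0..1})"

definition coupling_measure :: "real measure \<Rightarrow> ((real ^ 'd) set \<Rightarrow> real) measure" where
  "coupling_measure \<mu> = PiM lattice_edges (\<lambda>_. \<mu>)"

definition J_min :: "real measure \<Rightarrow> real" where
  "J_min \<mu> = Inf {l. 0 \<le> l \<and> measure \<mu> {j \<in> space \<mu>. j < l} > 0}"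

text \<open>
  The supremum is taken in \<open>[0, \<infinity>)\<close>: the element 0 is inserted because the set is empty when the
  couplings vanish almost surely, and \<open>Sup {}\<close> is unspecified on the reals.
\<close>

definition J_max :: "real measure \<Rightarrow> real" where
  "J_max \<mu> = Sup (insert 0 {l. 0 \<le> l \<and> measure \<mu> {j \<in> space \<mu>. j > l} > 0})"


definition linked :: "(real ^ 'd) set set \<Rightarrow> ((real ^ 'd) \<times> (real ^ 'd)) set" where
  "linked F = {(x, y). {x, y} \<in> F}\<^sup>*"

definition configs :: "(real ^ 'd) set set \<Rightarrow> ((real ^ 'd) set \<Rightarrow> nat) set" where
  "configs E = (\<Pi>\<^sub>E e\<in>E. {0, 1})"

text \<open>
  Only the values of the boundary condition \<open>\<pi>\<close> on lattice edges outside \<open>E\<close> matter.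
  The elements of the quotient below are the full clusters of the vertices touched by \<open>E\<close>; they
  may extend outside \<open>\<Union>E\<close>, but each of them is counted once.
\<close>

definition num_clusters ::
    "(real ^ 'd) set set \<Rightarrow> ((real ^ 'd) set \<Rightarrow> nat) \<Rightarrow> ((real ^ 'd) set \<Rightarrow> nat) \<Rightarrow> nat" where
  "num_clusters E \<pi> \<omega> =
     card (\<Union>E // linked ({e \<in> E. \<omega> e = 1} \<union> {e \<in> lattice_edges - E. \<pi> e = 1}))"

definition edge_prob :: "real \<Rightarrow> real \<Rightarrow> real" where
  "edge_prob \<beta> j = 1 - exp (- \<beta> * j)"

definition rc_weight ::
    "real \<Rightarrow> real \<Rightarrow> ((real ^ 'd) set \<Rightarrow> real) \<Rightarrow> (real ^ 'd) set set
      \<Rightarrow> ((real ^ 'd) set \<Rightarrow> nat) \<Rightarrow> ((real ^ 'd) set \<Rightarrow> nat) \<Rightarrow> real" where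
  "rc_weight q \<beta> J E \<pi> \<omega> =
     (\<Prod>e\<in>E. edge_prob \<beta> (J e) ^ \<omega> e * (1 - edge_prob \<beta> (J e)) ^ (1 - \<omega> e))
       * q ^ num_clusters E \<pi> \<omega>"

definition rc_measure ::
    "real \<Rightarrow> real \<Rightarrow> ((real ^ 'd) set \<Rightarrow> real) \<Rightarrow> (real ^ 'd) set set
      \<Rightarrow> ((real ^ 'd) set \<Rightarrow> nat) \<Rightarrow> ((real ^ 'd) set \<Rightarrow> nat) measure" where
  "rc_measure q \<beta> J E \<pi> =
     point_measure (configs E)
       (\<lambda>\<omega>. ennreal (rc_weight q \<beta> J E \<pi> \<omega> / (\<Sum>\<omega>'\<in>configs E. rc_weight q \<beta> J E \<pi> \<omega>')))"

definition wired :: "(real ^ 'd) set \<Rightarrow> nat" where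
  "wired = (\<lambda>_. 1)"


definition orthonormal_basis :: "(real ^ 'd) set \<Rightarrow> bool" where
  "orthonormal_basis B \<longleftrightarrow> pairwise orthogonal B \<and> (\<forall>b\<in>B. norm b = 1) \<and> span B = UNIV"

text \<open>
  The requirement \<open>n \<notin> U\<close> ensures that \<open>U\<close> consists of the \<open>d - 1\<close> basis vectors other than \<open>n\<close>.
\<close>

definition unit_cubes :: "real ^ 'd \<Rightarrow> (real ^ 'd) set set" where
  "unit_cubes n =
     {{\<Sum>u\<in>U. t u *\<^sub>R u | t. \<forall>u\<in>U. t u \<in> {-1/2..1/2}} | U. n \<notin> U \<and> orthonormal_basis (insert n U)}"

definition rect :: "real ^ 'd \<Rightarrow> real \<Rightarrow> real \<Rightarrow> (real ^ 'd) set \<Rightarrow> real ^ 'd \<Rightarrow> (real ^ 'd) set" where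
  "rect x L H S n = {x + L *\<^sub>R s + h *\<^sub>R n | s h. s \<in> S \<and> h \<in> {-H..H}}"

definition discretize :: "(real ^ 'd) set \<Rightarrow> (real ^ 'd) set" where
  "discretize R = int_lattice \<inter> interior R"

definition inner_boundary :: "(real ^ 'd) set \<Rightarrow> (real ^ 'd) set" where
  "inner_boundary V = {y \<in> V. \<exists>z \<in> int_lattice - V. norm (z - y) = 1}"

definition upper_boundary :: "real ^ 'd \<Rightarrow> real ^ 'd \<Rightarrow> (real ^ 'd) set \<Rightarrow> (real ^ 'd) set" where
  "upper_boundary x n V = {y \<in> inner_boundary V. (y - x) \<bullet> n \<ge> 0}"

definition lower_boundary :: "real ^ 'd \<Rightarrow> real ^ 'd \<Rightarrow> (real ^ 'd) set \<Rightarrow> (real ^ 'd) set" where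
  "lower_boundary x n V = {y \<in> inner_boundary V. (y - x) \<bullet> n < 0}"


definition disconnection :: "real ^ 'd \<Rightarrow> real ^ 'd \<Rightarrow> (real ^ 'd) set \<Rightarrow> ((real ^ 'd) set \<Rightarrow> nat) set" where
  "disconnection x n V =
     {\<omega> \<in> configs (edges_in V).
        \<not> (\<exists>y \<in> upper_boundary x n V. \<exists>z \<in> lower_boundary x n V.
              (y, z) \<in> linked {e \<in> edges_in V. \<omega> e = 1})}"

definition surface_tension ::
    "real \<Rightarrow> real \<Rightarrow> ((real ^ 'd) set \<Rightarrow> real)
      \<Rightarrow> real ^ 'd \<Rightarrow> real \<Rightarrow> real \<Rightarrow> (real ^ 'd) set \<Rightarrow> real ^ 'd \<Rightarrow> real" where
  "surface_tension q \<beta> J x L H S n =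
     (let V = discretize (rect x L H S n) in
       - (1 / L ^ (CARD('d) - 1))
         * ln (measure (rc_measure q \<beta> J (edges_in V) wired) (disconnection x n V)))"

end

theory Submission
  imports Defs
begin

text \<open>
  For wired boundary conditions and \<open>q \<ge> 1\<close>, the random cluster measure is stochastically increasing
  in the edge probabilities, and the event that the two halves of the boundary are disconnected is
  decreasing. So its probability decreases, and the surface tension increases, when \<open>J\<close> or \<open>\<beta>\<close>
  grows. Stochastic monotonicity is the Holley inequality (\<open>Holley_decreasing\<close>, \<open>wired_prob_antimono\<close>),
  which is derived from the four functions theorem of Ahlswede and Daykin; its hypothesis holds
  because the number of clusters is a supermodular function of the set of open edges
  (\<open>wired_clusters_supermodular\<close>).

  Monotonicity in \<open>H\<close> has a probabilistic and a geometric part. The wired measure on a smaller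
  domain is the wired measure on the larger one in which the additional edges have probability
  \<open>1\<close> (\<open>wired_prob_enlarge\<close>), so a decreasing event that concerns the smaller domain is more
  likely in the larger one. Moreover, a path that joins the two halves of the boundary of the
  higher rectangle contains a path that joins the two halves of the boundary of the lower rectangle
  (\<open>separating_enlarge\<close>).

  For the upper bound, monotonicity in \<open>H\<close> reduces to the smallest height \<open>2 * sqrt d\<close>. The
  configuration with all edges closed is disconnected and has probability at least
  \<open>exp (- \<beta> * J)\<close> to the number of edges (\<open>prod_closed_le_wired_prob\<close>), and at this height the
  rectangle contains at most a constant times \<open>L\<close> to the power \<open>d - 1\<close> edges
  (\<open>card_lattice_slab_le\<close>).

  The almost sure bounds by the constant couplings follow from monotonicity in \<open>J\<close>, since almost
  surely all of the countably many couplings lie between \<open>J_min\<close> and \<open>J_max\<close>.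
\<close>

section \<open>The four functions theorem and the Holley inequality\<close>

text \<open>
  The case of a one-point ground set. Writing \<open>m = c1 * d0\<close>, the two mixed products \<open>a0 * b1\<close> and
  \<open>a1 * b0\<close> are both at most \<open>m\<close>, so that \<open>(m - a0 * b1) * (m - a1 * b0) \<ge> 0\<close>; this is the claim
  after multiplication by \<open>m\<close>. When \<open>m = 0\<close>, both mixed products vanish.
\<close>

lemma four_functions_step:
  fixes a0 a1 b0 b1 c0 c1 d0 d1 :: real
  assumes nonneg: "0 \<le> a0" "0 \<le> a1" "0 \<le> b0" "0 \<le> b1" "0 \<le> c0" "0 \<le> c1" "0 \<le> d0" "0 \<le> d1"
    and "a0 * b0 \<le> c0 * d0" "a0 * b1 \<le> c1 * d0" "a1 * b0 \<le> c1 * d0" "a1 * b1 \<le> c1 * d1"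
  shows "(a0 + a1) * (b0 + b1) \<le> (c0 + c1) * (d0 + d1)"
proof (cases "c1 * d0 = 0")
  case True
  then have "a0 * b1 = 0" "a1 * b0 = 0"
    using assms(10,11) mult_nonneg_nonneg[OF assms(1,4)] mult_nonneg_nonneg[OF assms(2,3)] by linarith+
  then have "(a0 + a1) * (b0 + b1) = a0 * b0 + a1 * b1"
    unfolding distrib_left distrib_right by linarith
  also have "\<dots> \<le> c0 * d0 + c1 * d1"
    using assms(9,12) by (rule add_mono)
  also have "\<dots> \<le> (c0 + c1) * (d0 + d1)"
    using nonneg by (simp add: algebra_simps)
  finally show ?thesis .
next
  case False
  define m where "m = c1 * d0"
  have "m > 0"
    using False nonneg by (simp add: m_def order_less_le)
  have "m * ((a0 + a1) * (b0 + b1)) \<le> (a0 * b0 + m) * (m + a1 * b1)"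
  proof -
    have "0 \<le> (m - a0 * b1) * (m - a1 * b0)"
      unfolding m_def using assms(10,11) by (intro mult_nonneg_nonneg) simp_all
    then show ?thesis
      by (simp add: algebra_simps)
  qed
  also have "\<dots> \<le> (c0 * d0 + m) * (m + c1 * d1)"
    using nonneg assms(9,12) \<open>m > 0\<close> mult_nonneg_nonneg[OF assms(5,7)] mult_nonneg_nonneg[OF assms(2,4)]
    by (intro mult_mono) linarith+
  also have "\<dots> = m * ((c0 + c1) * (d0 + d1))"
    by (simp add: m_def algebra_simps)
  finally show ?thesis
    using \<open>m > 0\<close> by simp
qed

lemma sum_Pow_insert:
  assumes "finite E" "e \<notin> E"
  shows "(\<Sum>A\<in>Pow (insert e E). f A) = (\<Sum>A\<in>Pow E. f A + f (insert e A))"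
proof -
  have "inj_on (insert e) (Pow E)"
    using assms(2) by (auto simp: inj_on_def)
  moreover have "Pow E \<inter> insert e ` Pow E = {}"
    using assms(2) by auto
  ultimately show ?thesis
    using assms(1) by (simp add: Pow_insert sum.union_disjoint sum.reindex sum.distrib)
qed

text \<open>
  The theorem of Ahlswede and Daykin. One element \<open>e\<close> is removed at a time: each function is replaced
  by its sum over the two states of \<open>e\<close>, and the one-point case says that this preserves the
  hypothesis.
\<close>

theorem four_functions:
  fixes a b c d :: "'a set \<Rightarrow> real"
  assumes "finite E"
    and "\<And>A. 0 \<le> a A" "\<And>A. 0 \<le> b A" "\<And>A. 0 \<le> c A" "\<And>A. 0 \<le> d A"
    and "\<And>A B. A \<subseteq> E \<Longrightarrow> B \<subseteq> E \<Longrightarrow> a A * b B \<le> c (A \<union> B) * d (A \<inter> B)"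
  shows "(\<Sum>A\<in>Pow E. a A) * (\<Sum>A\<in>Pow E. b A) \<le> (\<Sum>A\<in>Pow E. c A) * (\<Sum>A\<in>Pow E. d A)"
  using assms
proof (induction E arbitrary: a b c d rule: finite_induct)
  case empty
  then show ?case
    by simp
next
  case (insert e E)
  have "(\<Sum>A\<in>Pow E. a A + a (insert e A)) * (\<Sum>A\<in>Pow E. b A + b (insert e A))
      \<le> (\<Sum>A\<in>Pow E. c A + c (insert e A)) * (\<Sum>A\<in>Pow E. d A + d (insert e A))"
  proof (rule insert.IH)
    fix A B
    assume "A \<subseteq> E" "B \<subseteq> E"
    then have e: "e \<notin> A" "e \<notin> B" and sub: "A \<subseteq> insert e E" "B \<subseteq> insert e E"
      "insert e A \<subseteq> insert e E" "insert e B \<subseteq> insert e E"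
      using insert.hyps by auto
    show "(a A + a (insert e A)) * (b B + b (insert e B))
        \<le> (c (A \<union> B) + c (insert e (A \<union> B))) * (d (A \<inter> B) + d (insert e (A \<inter> B)))"
    proof (rule four_functions_step)
      show "a A * b (insert e B) \<le> c (insert e (A \<union> B)) * d (A \<inter> B)"
        using insert.prems(5)[OF sub(1) sub(4)] e by simp
      show "a (insert e A) * b B \<le> c (insert e (A \<union> B)) * d (A \<inter> B)"
        using insert.prems(5)[OF sub(3) sub(2)] e by simp
      show "a (insert e A) * b (insert e B) \<le> c (insert e (A \<union> B)) * d (insert e (A \<inter> B))"
        using insert.prems(5)[OF sub(3) sub(4)] e by simp
    qed (use insert.prems sub in auto)
  qed (use insert.prems in auto)
  then show ?case
    using insert.hyps by (simp add: sum_Pow_insert)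
qed

text \<open>
  An event is a family of sets of open edges; opening fewer edges may not leave it.
\<close>

definition decreasing_event :: "'a set set \<Rightarrow> bool" where
  "decreasing_event D \<longleftrightarrow> (\<forall>A\<in>D. \<forall>B\<subseteq>A. B \<in> D)"

text \<open>
  In terms of the normalized measures, \<open>w'\<close> gives a decreasing event at most the mass that \<open>w\<close> gives
  it. This is the four functions theorem for \<open>w'\<close> and \<open>w\<close>, the first restricted to \<open>D\<close> on the left
  and the second restricted to \<open>D\<close> on the right: if \<open>A\<close> lies in \<open>D\<close>, so does \<open>A \<inter> B\<close>. The total
  masses are kept on both sides because they may be zero.
\<close>

lemma Holley_decreasing:
  fixes w w' :: "'a set \<Rightarrow> real"
  assumes "finite E" "\<And>A. 0 \<le> w A" "\<And>A. 0 \<le> w' A"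
    and lattice: "\<And>A B. A \<subseteq> E \<Longrightarrow> B \<subseteq> E \<Longrightarrow> w' A * w B \<le> w' (A \<union> B) * w (A \<inter> B)"
    and D: "decreasing_event D"
  shows "(\<Sum>A\<in>Pow E \<inter> D. w' A) * (\<Sum>A\<in>Pow E. w A) \<le> (\<Sum>A\<in>Pow E. w' A) * (\<Sum>A\<in>Pow E \<inter> D. w A)"
proof -
  have "(\<Sum>A\<in>Pow E. if A \<in> D then w' A else 0) * (\<Sum>A\<in>Pow E. w A)
      \<le> (\<Sum>A\<in>Pow E. w' A) * (\<Sum>A\<in>Pow E. if A \<in> D then w A else 0)"
  proof (rule four_functions)
    fix A B
    assume AB: "A \<subseteq> E" "B \<subseteq> E"
    show "(if A \<in> D then w' A else 0) * w B \<le> w' (A \<union> B) * (if A \<inter> B \<in> D then w (A \<inter> B) else 0)"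
    proof (cases "A \<in> D")
      case True
      then have "A \<inter> B \<in> D"
        using D by (auto simp: decreasing_event_def)
      then show ?thesis
        using True lattice[OF AB] by simp
    next
      case False
      then show ?thesis
        using assms(2,3) by simp
    qed
  qed (use assms in auto)
  then show ?thesis
    using \<open>finite E\<close> by (simp add: sum.inter_restrict)
qed

section \<open>Counting clusters\<close>

lemma linked_refl [simp]: "(x, x) \<in> linked F"
  by (simp add: linked_def)

lemma linked_edge: "{x, y} \<in> F \<Longrightarrow> (x, y) \<in> linked F"
  by (auto simp: linked_def)

lemma linked_trans: "(x, y) \<in> linked F \<Longrightarrow> (y, z) \<in> linked F \<Longrightarrow> (x, z) \<in> linked F"
  unfolding linked_def by (rule rtrancl_trans)

lemma linked_sym: "(x, y) \<in> linked F \<Longrightarrow> (y, x) \<in> linked F"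
  unfolding linked_def
  by (rule symD[OF sym_rtrancl]) (auto simp: sym_def insert_commute)

lemma linked_mono: "F \<subseteq> G \<Longrightarrow> linked F \<subseteq> linked G"
  unfolding linked_def by (intro rtrancl_mono) auto

lemma equiv_linked: "equiv UNIV (linked F)"
  by (intro equivI refl_onI symI transI) (auto intro: linked_sym linked_trans)

lemma linked_insert:
  "(x, y) \<in> linked (insert {u, v} F) \<longleftrightarrow> (x, y) \<in> linked F
     \<or> (x, u) \<in> linked F \<and> (v, y) \<in> linked F \<or> (x, v) \<in> linked F \<and> (u, y) \<in> linked F"
    (is "?L x y \<longleftrightarrow> ?P y")
proof
  assume "?L x y"
  then have "(x, y) \<in> {(x, y). {x, y} \<in> insert {u, v} F}\<^sup>*"
    by (simp add: linked_def)
  then show "?P y"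
  proof (induction rule: rtrancl_induct)
    case base
    then show ?case
      by simp
  next
    case (step y z)
    then consider "y = u" "z = v" | "y = v" "z = u" | "{y, z} \<in> F"
      by (auto simp: doubleton_eq_iff)
    then show ?case
    proof cases
      case 3
      then show ?thesis
        using step.IH linked_edge[of y z F] by (meson linked_trans)
    qed (use step.IH in auto)
  qed
next
  have mono: "(a, b) \<in> linked (insert {u, v} F)" if "(a, b) \<in> linked F" for a b
    using that linked_mono[of F "insert {u, v} F"] by auto
  have "(u, v) \<in> linked (insert {u, v} F)"
    by (rule linked_edge) simp
  then show "?L x y" if "?P y"
    using that by (meson mono linked_trans linked_sym)
qed

lemma linked_insert_redundant:
  assumes "(u, v) \<in> linked F"
  shows "linked (insert {u, v} F) = linked F"
proof -
  have "(x, y) \<in> linked (insert {u, v} F) \<longleftrightarrow> (x, y) \<in> linked F" for x y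
    unfolding linked_insert using assms by (meson linked_trans linked_sym)
  then show ?thesis
    by (auto intro!: set_eqI)
qed

definition clusters_meeting where
  "clusters_meeting V F = card (V // linked F)"

text \<open>
  An edge between two different clusters replaces them by their union and leaves all others alone.
\<close>

lemma clusters_meeting_merge:
  assumes "finite V" "u \<in> V" "v \<in> V" and uv: "(u, v) \<notin> linked F"
  shows "clusters_meeting V (insert {u, v} F) + 1 = clusters_meeting V F"
proof -
  let ?R = "linked F" and ?R' = "linked (insert {u, v} F)"
  let ?U = "?R `` {u}" and ?V = "?R `` {v}"
  note E = equiv_linked[of F]
  have cls: "?R' `` {x} = (if (x, u) \<in> ?R \<or> (x, v) \<in> ?R then ?U \<union> ?V else ?R `` {x})" for x
  proof (cases "(x, u) \<in> ?R \<or> (x, v) \<in> ?R")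
    case True
    then have "y \<in> ?R' `` {x} \<longleftrightarrow> y \<in> ?U \<union> ?V" for y
      unfolding linked_insert Image_singleton_iff Un_iff by (meson linked_trans linked_sym)
    with True show ?thesis
      by auto
  next
    case False
    then show ?thesis
      by (auto simp: linked_insert)
  qed
  have self: "x \<in> ?R `` {x}" for x
    by simp
  have eq: "?R `` {x} = ?R `` {y} \<longleftrightarrow> (x, y) \<in> ?R" for x y
    using E by (simp add: eq_equiv_class_iff)
  have "V // ?R' = insert (?U \<union> ?V) (V // ?R - {?U, ?V})"
  proof (intro equalityI subsetI)
    fix C
    assume "C \<in> V // ?R'"
    then obtain x where "x \<in> V" "C = ?R' `` {x}"
      by (auto elim: quotientE)
    then have "C \<in> V // ?R \<and> C \<noteq> ?U \<and> C \<noteq> ?V" if "C \<noteq> ?U \<union> ?V"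
      using that cls[of x] by (simp add: quotientI eq split: if_splits)
    then show "C \<in> insert (?U \<union> ?V) (V // ?R - {?U, ?V})"
      by blast
  next
    fix C
    assume "C \<in> insert (?U \<union> ?V) (V // ?R - {?U, ?V})"
    then consider "C = ?U \<union> ?V" | x where "x \<in> V" "C = ?R `` {x}" "C \<noteq> ?U" "C \<noteq> ?V"
      by (auto elim!: quotientE)
    then show "C \<in> V // ?R'"
    proof cases
      case 1
      then have "C = ?R' `` {u}"
        by (simp add: cls)
      then show ?thesis
        using \<open>u \<in> V\<close> by (simp add: quotientI)
    next
      case 2
      then have "C = ?R' `` {x}"
        by (simp add: cls eq)
      then show ?thesis
        using \<open>x \<in> V\<close> by (simp add: quotientI)
    qed
  qed
  moreover have "?U \<union> ?V \<notin> V // ?R - {?U, ?V}"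
  proof
    assume "?U \<union> ?V \<in> V // ?R - {?U, ?V}"
    then obtain x where "?U \<union> ?V = ?R `` {x}"
      by (auto elim!: quotientE)
    then have "(x, u) \<in> ?R" "(x, v) \<in> ?R"
      using self by blast+
    then show False
      using uv by (meson linked_trans linked_sym)
  qed
  moreover have fin: "finite (V // ?R)"
    using \<open>finite V\<close> by (simp add: quotient_def)
  ultimately have "card (V // ?R') = Suc (card (V // ?R - {?U, ?V}))"
    by simp
  moreover have "card (V // ?R - {?U, ?V}) = card (V // ?R) - 2"
    using assms fin by (subst card_Diff_subset) (simp_all add: quotientI eq)
  moreover have "card {?U, ?V} \<le> card (V // ?R)"
    using assms fin by (intro card_mono) (auto simp: quotientI)
  then have "2 \<le> card (V // ?R)"
    using uv by (simp add: eq)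
  ultimately show ?thesis
    by (simp add: clusters_meeting_def)
qed

lemma clusters_meeting_insert:
  assumes "finite V" "u \<in> V" "v \<in> V"
  shows "clusters_meeting V F
    = clusters_meeting V (insert {u, v} F) + (if (u, v) \<in> linked F then 0 else 1)"
  using clusters_meeting_merge[OF assms]
  by (auto simp: clusters_meeting_def linked_insert_redundant)

text \<open>
  The more edges are already present, the fewer clusters are lost by adding \<open>T\<close>: an edge that merges
  two clusters of the larger graph also merges two clusters of the smaller one.
\<close>

lemma clusters_meeting_diminishing:
  assumes "finite V" "finite T" "\<And>e. e \<in> T \<Longrightarrow> \<exists>u\<in>V. \<exists>v\<in>V. e = {u, v}" "X \<subseteq> Y"
  shows "clusters_meeting V Y + clusters_meeting V (X \<union> T)
    \<le> clusters_meeting V X + clusters_meeting V (Y \<union> T)"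
  using assms(2,3)
proof (induction T rule: finite_induct)
  case empty
  then show ?case
    by simp
next
  case (insert e T)
  then obtain u v where uv: "u \<in> V" "v \<in> V" "e = {u, v}"
    by blast
  have "linked (X \<union> T) \<subseteq> linked (Y \<union> T)"
    using \<open>X \<subseteq> Y\<close> by (intro linked_mono) auto
  then show ?case
    using insert.IH insert.prems uv
      clusters_meeting_insert[OF \<open>finite V\<close> uv(1,2), of "X \<union> T"]
      clusters_meeting_insert[OF \<open>finite V\<close> uv(1,2), of "Y \<union> T"]
    by (auto split: if_splits)
qed

lemma clusters_meeting_antimono:
  assumes "finite V" "finite T" "\<And>e. e \<in> T \<Longrightarrow> \<exists>u\<in>V. \<exists>v\<in>V. e = {u, v}"
  shows "clusters_meeting V (X \<union> T) \<le> clusters_meeting V X"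
  using assms(2,3)
proof (induction T rule: finite_induct)
  case empty
  then show ?case
    by simp
next
  case (insert e T)
  then obtain u v where uv: "u \<in> V" "v \<in> V" "e = {u, v}"
    by blast
  show ?case
    using insert.IH insert.prems uv clusters_meeting_insert[OF \<open>finite V\<close> uv(1,2), of "X \<union> T"]
    by (auto split: if_splits)
qed

section \<open>The wired random cluster measure on sets of open edges\<close>

text \<open>
  The cluster count of the random cluster model with every lattice edge outside \<open>E\<close> open, as a
  function of the set \<open>A\<close> of open edges in \<open>E\<close>. Passing from \<open>0\<close>-\<open>1\<close> configurations to sets turns the
  product order into inclusion, which is the form needed for the four functions theorem.
\<close>

definition wired_clusters :: "(real ^ 'd) set set \<Rightarrow> (real ^ 'd) set set \<Rightarrow> nat" where
  "wired_clusters E A = clusters_meeting (\<Union>E) (A \<union> (lattice_edges - E))"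

text \<open>
  The weight takes edge probabilities \<open>p\<close> instead of couplings, so that the value \<open>1\<close>, which no
  coupling attains, can be used to wire edges.
\<close>

definition wired_weight ::
    "real \<Rightarrow> ((real ^ 'd) set \<Rightarrow> real) \<Rightarrow> (real ^ 'd) set set \<Rightarrow> (real ^ 'd) set set \<Rightarrow> real" where
  "wired_weight q p E A = (\<Prod>e\<in>E. if e \<in> A then p e else 1 - p e) * q ^ wired_clusters E A"

definition wired_prob ::
    "real \<Rightarrow> ((real ^ 'd) set \<Rightarrow> real) \<Rightarrow> (real ^ 'd) set set \<Rightarrow> (real ^ 'd) set set set \<Rightarrow> real" where
  "wired_prob q p E D = (\<Sum>A\<in>Pow E \<inter> D. wired_weight q p E A) / (\<Sum>A\<in>Pow E. wired_weight q p E A)"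

lemma edges_in_doubleton: "e \<in> edges_in V \<Longrightarrow> \<exists>x y. e = {x, y}"
  by (auto simp: edges_in_def)

lemma finite_Union_edges:
  assumes "finite E" "E \<subseteq> lattice_edges"
  shows "finite (\<Union>E)"
proof (rule finite_Union)
  fix e
  assume "e \<in> E"
  then have "e \<in> lattice_edges"
    using assms(2) by auto
  then show "finite e"
    by (auto dest!: edges_in_doubleton)
qed fact

lemma edge_endpoints:
  assumes "E \<subseteq> lattice_edges" "e \<in> E"
  shows "\<exists>u\<in>\<Union>E. \<exists>v\<in>\<Union>E. e = {u, v}"
proof -
  obtain u v where "e = {u, v}"
    using assms edges_in_doubleton by blast
  then show ?thesis
    using \<open>e \<in> E\<close> by blast
qed

text \<open>
  Instance of diminishing returns: adding \<open>B - A\<close> to \<open>A \<inter> B\<close> loses at least as many clusters as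
  adding it to the larger set \<open>A\<close>.
\<close>

lemma wired_clusters_supermodular:
  assumes E: "finite E" "E \<subseteq> lattice_edges" and "A \<subseteq> E" "B \<subseteq> E"
  shows "wired_clusters E A + wired_clusters E B \<le> wired_clusters E (A \<union> B) + wired_clusters E (A \<inter> B)"
proof -
  let ?O = "lattice_edges - E"
  have "clusters_meeting (\<Union>E) (A \<union> ?O) + clusters_meeting (\<Union>E) (A \<inter> B \<union> ?O \<union> (B - A))
      \<le> clusters_meeting (\<Union>E) (A \<inter> B \<union> ?O) + clusters_meeting (\<Union>E) (A \<union> ?O \<union> (B - A))"
    using E \<open>B \<subseteq> E\<close> edge_endpoints[OF E(2)]
    by (intro clusters_meeting_diminishing finite_Union_edges) (auto intro: finite_subset)
  moreover have "A \<inter> B \<union> ?O \<union> (B - A) = B \<union> ?O" "A \<union> ?O \<union> (B - A) = A \<union> B \<union> ?O"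
    by auto
  ultimately show ?thesis
    by (simp add: wired_clusters_def)
qed

lemma wired_clusters_le_empty:
  assumes "finite E" "E \<subseteq> lattice_edges" and "A \<subseteq> E"
  shows "wired_clusters E A \<le> wired_clusters E {}"
proof -
  have "clusters_meeting (\<Union>E) ((lattice_edges - E) \<union> A) \<le> clusters_meeting (\<Union>E) (lattice_edges - E)"
    using assms edge_endpoints[OF assms(2)]
    by (intro clusters_meeting_antimono finite_Union_edges) (auto intro: finite_subset)
  then show ?thesis
    by (simp add: wired_clusters_def Un_commute)
qed

lemma wired_weight_nonneg:
  assumes "q \<ge> 1" "\<And>e. e \<in> E \<Longrightarrow> 0 \<le> p e" "\<And>e. e \<in> E \<Longrightarrow> p e \<le> 1"
  shows "0 \<le> wired_weight q p E A"
  unfolding wired_weight_def using assms by (intro mult_nonneg_nonneg prod_nonneg) auto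

text \<open>
  The hypothesis of the Holley inequality. The cluster factor satisfies it because the exponent is
  supermodular and \<open>q \<ge> 1\<close>. In the product over the edges, equality holds except at the edges
  of \<open>B - A\<close>, where the claim is \<open>(1 - p' e) * p e \<le> p' e * (1 - p e)\<close>, that is \<open>p e \<le> p' e\<close>.
\<close>

lemma wired_weight_lattice_condition:
  assumes E: "finite E" "E \<subseteq> lattice_edges" and AB: "A \<subseteq> E" "B \<subseteq> E" and "q \<ge> 1"
    and p: "\<And>e. e \<in> E \<Longrightarrow> 0 \<le> p e" "\<And>e. e \<in> E \<Longrightarrow> p e \<le> p' e" "\<And>e. e \<in> E \<Longrightarrow> p' e \<le> 1"
  shows "wired_weight q p' E A * wired_weight q p E B
    \<le> wired_weight q p' E (A \<union> B) * wired_weight q p E (A \<inter> B)"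
proof -
  let ?f = "\<lambda>p A e. if e \<in> A then p e else 1 - p e :: real"
  have pointwise: "0 \<le> ?f p' A e * ?f p B e \<and> ?f p' A e * ?f p B e \<le> ?f p' (A \<union> B) e * ?f p (A \<inter> B) e"
    if "e \<in> E" for e
  proof -
    have "0 \<le> p e" "p e \<le> p' e" "p' e \<le> 1"
      using p that by auto
    moreover from this have "(1 - p' e) * p e \<le> p' e * (1 - p e)"
      by (simp add: algebra_simps)
    ultimately show ?thesis
      by simp
  qed
  have "(\<Prod>e\<in>E. ?f p' A e * ?f p B e) \<le> (\<Prod>e\<in>E. ?f p' (A \<union> B) e * ?f p (A \<inter> B) e)"
    by (rule prod_mono) (rule pointwise)
  moreover have "0 \<le> (\<Prod>e\<in>E. ?f p' (A \<union> B) e * ?f p (A \<inter> B) e)"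
    by (rule prod_nonneg) (use pointwise in force)
  moreover have "q ^ (wired_clusters E A + wired_clusters E B)
      \<le> q ^ (wired_clusters E (A \<union> B) + wired_clusters E (A \<inter> B))"
    using wired_clusters_supermodular[OF E AB] \<open>q \<ge> 1\<close> by (rule power_increasing)
  ultimately have "(\<Prod>e\<in>E. ?f p' A e * ?f p B e) * q ^ (wired_clusters E A + wired_clusters E B)
     \<le> (\<Prod>e\<in>E. ?f p' (A \<union> B) e * ?f p (A \<inter> B) e)
        * q ^ (wired_clusters E (A \<union> B) + wired_clusters E (A \<inter> B))"
    using \<open>q \<ge> 1\<close> by (intro mult_mono) auto
  then show ?thesis
    unfolding wired_weight_def power_add prod.distrib by (simp only: mult_ac)
qed

lemma wired_partition_pos:
  assumes "finite E" "q \<ge> 1" "\<And>e. e \<in> E \<Longrightarrow> 0 \<le> p e" "\<And>e. e \<in> E \<Longrightarrow> p e < 1"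
  shows "0 < (\<Sum>A\<in>Pow E. wired_weight q p E A)"
proof (rule sum_pos2)
  show "0 < wired_weight q p E {}"
    unfolding wired_weight_def using assms by (auto intro!: mult_pos_pos prod_pos)
  show "0 \<le> wired_weight q p E A" for A
    using assms by (intro wired_weight_nonneg) (auto intro: less_imp_le)
qed (use \<open>finite E\<close> in auto)

lemma wired_prob_antimono:
  assumes E: "finite E" "E \<subseteq> lattice_edges" and "q \<ge> 1"
    and p: "\<And>e. e \<in> E \<Longrightarrow> 0 \<le> p e" "\<And>e. e \<in> E \<Longrightarrow> p e \<le> p' e" "\<And>e. e \<in> E \<Longrightarrow> p' e \<le> 1"
    and Z: "0 < (\<Sum>A\<in>Pow E. wired_weight q p E A)" "0 < (\<Sum>A\<in>Pow E. wired_weight q p' E A)"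
    and D: "decreasing_event D"
  shows "wired_prob q p' E D \<le> wired_prob q p E D"
proof -
  have "(\<Sum>A\<in>Pow E \<inter> D. wired_weight q p' E A) * (\<Sum>A\<in>Pow E. wired_weight q p E A)
      \<le> (\<Sum>A\<in>Pow E. wired_weight q p' E A) * (\<Sum>A\<in>Pow E \<inter> D. wired_weight q p E A)"
    using p by (intro Holley_decreasing wired_weight_nonneg wired_weight_lattice_condition assms)
      (auto intro: order_trans)
  then show ?thesis
    unfolding wired_prob_def using Z by (simp add: field_simps)
qed

text \<open>
  The event contains the configuration with all edges closed. This configuration has the
  largest number of clusters, so the factor \<open>q ^ k\<close> only favours it, and its probability is at
  least its probability under independent percolation (the case \<open>q = 1\<close>).
\<close>

lemma prod_closed_le_wired_prob:
  assumes E: "finite E" "E \<subseteq> lattice_edges" and "q \<ge> 1"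
    and p: "\<And>e. e \<in> E \<Longrightarrow> 0 \<le> p e" "\<And>e. e \<in> E \<Longrightarrow> p e < 1"
    and D: "{} \<in> D"
  shows "(\<Prod>e\<in>E. 1 - p e) \<le> wired_prob q p E D"
proof -
  let ?f = "\<lambda>A e. if e \<in> A then p e else 1 - p e :: real"
  let ?k = "wired_clusters E {}"
  have nonneg: "0 \<le> wired_weight q p E A" for A
    using p \<open>q \<ge> 1\<close> by (intro wired_weight_nonneg) (auto intro: less_imp_le)
  have "(\<Sum>A\<in>Pow E. \<Prod>e\<in>E. ?f A e) = (\<Prod>e\<in>E. p e + (1 - p e))"
    unfolding prod_add[OF E(1)] using E(1)
    by (intro sum.cong) (auto simp: prod.If_cases Int_absorb1 Diff_eq)
  then have total: "(\<Sum>A\<in>Pow E. \<Prod>e\<in>E. ?f A e) = 1"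
    by simp
  have "(\<Sum>A\<in>Pow E. wired_weight q p E A) \<le> (\<Sum>A\<in>Pow E. (\<Prod>e\<in>E. ?f A e) * q ^ ?k)"
  proof (rule sum_mono)
    fix A
    assume "A \<in> Pow E"
    then show "wired_weight q p E A \<le> (\<Prod>e\<in>E. ?f A e) * q ^ ?k"
      unfolding wired_weight_def using p \<open>q \<ge> 1\<close> E
      by (intro mult_left_mono power_increasing wired_clusters_le_empty prod_nonneg)
        (auto intro: less_imp_le)
  qed
  also have "\<dots> = q ^ ?k"
    unfolding sum_distrib_right[symmetric] total by simp
  finally have Z: "(\<Sum>A\<in>Pow E. wired_weight q p E A) \<le> q ^ ?k" .
  have "(\<Prod>e\<in>E. 1 - p e) * (\<Sum>A\<in>Pow E. wired_weight q p E A) \<le> (\<Prod>e\<in>E. 1 - p e) * q ^ ?k"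
    using Z p by (intro mult_left_mono prod_nonneg) (auto intro: less_imp_le)
  also have "\<dots> = wired_weight q p E {}"
    by (simp add: wired_weight_def)
  also have "\<dots> \<le> (\<Sum>A\<in>Pow E \<inter> D. wired_weight q p E A)"
    using D E(1) nonneg by (intro member_le_sum) auto
  finally show ?thesis
    unfolding wired_prob_def using wired_partition_pos[OF E(1) \<open>q \<ge> 1\<close> p]
    by (simp add: pos_le_divide_eq)
qed

subsection \<open>Wiring the outside edges\<close>

text \<open>
  A cluster of \<open>G\<close> that touches no edge of \<open>A\<close> is not changed by opening the edges of \<open>A\<close>.
\<close>

lemma linked_Un_eq:
  assumes "linked G `` {x} \<inter> \<Union>A = {}"
  shows "linked (A \<union> G) `` {x} = linked G `` {x}"
proof
  show "linked G `` {x} \<subseteq> linked (A \<union> G) `` {x}"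
    using linked_mono[of G "A \<union> G"] by auto
  show "linked (A \<union> G) `` {x} \<subseteq> linked G `` {x}"
  proof
    fix y
    assume "y \<in> linked (A \<union> G) `` {x}"
    then have "(x, y) \<in> {(x, y). {x, y} \<in> A \<union> G}\<^sup>*"
      by (simp add: linked_def)
    then show "y \<in> linked G `` {x}"
    proof (induction rule: rtrancl_induct)
      case base
      then show ?case
        by simp
    next
      case (step y z)
      then have "{y, z} \<notin> A"
        using assms by blast
      then have "(y, z) \<in> linked G"
        using step.hyps by (auto intro: linked_edge)
      then show ?case
        using step.IH linked_trans[of x y G z] by simp
    qed
  qed
qed

text \<open>
  The clusters that meet \<open>U'\<close> but not \<open>U\<close> are the same for every \<open>A\<close> whose edges live on \<open>U\<close>.
  Hence counting on \<open>U'\<close> instead of \<open>U\<close> shifts the number of clusters by a constant, which cancels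
  in the normalized measure.
\<close>

lemma clusters_meeting_enlarge:
  assumes "finite U'" "U \<subseteq> U'" "\<Union>A \<subseteq> U"
  shows "clusters_meeting U' (A \<union> G) = clusters_meeting U (A \<union> G) + card (U' // linked G - U // linked G)"
proof -
  have away: "C \<inter> U = {}" if "C \<in> U' // linked F - U // linked F" for C F
  proof (rule ccontr)
    assume "C \<inter> U \<noteq> {}"
    then obtain y where y: "y \<in> C" "y \<in> U"
      by blast
    from that obtain x where x: "C = linked F `` {x}"
      by (auto elim: quotientE)
    then have "C = linked F `` {y}"
      using equiv_class_eq[OF equiv_linked, of x y F] y by simp
    then show False
      using that y(2) by (simp add: quotientI)
  qed
  have meets: "C \<inter> U \<noteq> {}" if "C \<in> U // linked F" for C F
    using that by (auto elim!: quotientE)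
  have "U' // linked (A \<union> G) - U // linked (A \<union> G) = U' // linked G - U // linked G"
  proof (intro equalityI subsetI)
    fix C
    assume C: "C \<in> U' // linked (A \<union> G) - U // linked (A \<union> G)"
    then obtain x where x: "x \<in> U'" "C = linked (A \<union> G) `` {x}"
      by (auto elim: quotientE)
    have "linked G `` {x} \<subseteq> C"
      using x linked_mono[of G "A \<union> G"] by auto
    then have "linked G `` {x} \<inter> \<Union>A = {}"
      using away[OF C] assms(3) by blast
    then have "C = linked G `` {x}"
      using x linked_Un_eq by blast
    then show "C \<in> U' // linked G - U // linked G"
      using x(1) away[OF C] meets[of C G] by (auto simp: quotientI)
  next
    fix C
    assume C: "C \<in> U' // linked G - U // linked G"
    then obtain x where x: "x \<in> U'" "C = linked G `` {x}"
      by (auto elim: quotientE)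
    then have "linked G `` {x} \<inter> \<Union>A = {}"
      using away[OF C] assms(3) by blast
    then have "C = linked (A \<union> G) `` {x}"
      using x linked_Un_eq by blast
    then show "C \<in> U' // linked (A \<union> G) - U // linked (A \<union> G)"
      using x(1) away[OF C] meets[of C "A \<union> G"] by (auto simp: quotientI)
  qed
  moreover have "card (U' // linked (A \<union> G)) = card (U // linked (A \<union> G))
      + card (U' // linked (A \<union> G) - U // linked (A \<union> G))"
  proof -
    have "finite (U' // linked (A \<union> G))" "U // linked (A \<union> G) \<subseteq> U' // linked (A \<union> G)"
      using assms(1,2) by (auto simp: quotient_def)
    then show ?thesis
      by (metis card_Diff_subset card_mono finite_subset le_add_diff_inverse)
  qed
  ultimately show ?thesis
    by (simp add: clusters_meeting_def)
qed

text \<open>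
  Giving probability \<open>1\<close> to the edges of \<open>E' - E\<close> forces them to be open, which is what the wired
  boundary condition on \<open>E\<close> does. So the wired measure on \<open>E\<close> is a wired measure on \<open>E'\<close> with
  larger edge probabilities. Replacing conditioning on the edges of \<open>E' - E\<close> being open by this change
  of parameters covers edges of probability \<open>0\<close> as well. The second part transfers positivity of
  the partition function.
\<close>

lemma wired_prob_enlarge:
  fixes p :: "(real ^ 'd) set \<Rightarrow> real"
  assumes E': "finite E'" "E' \<subseteq> lattice_edges" and "E \<subseteq> E'" and "q \<ge> 1"
  defines "p' \<equiv> \<lambda>e. if e \<in> E then p e else 1"
  shows "wired_prob q p' E' {A. A \<inter> E \<in> D} = wired_prob q p E D"
    and "\<exists>c>0. (\<Sum>A\<in>Pow E'. wired_weight q p' E' A) = c * (\<Sum>A\<in>Pow E. wired_weight q p E A)"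
proof -
  define O' where "O' = lattice_edges - E"
  define c where "c = card (\<Union>E' // linked O' - \<Union>E // linked O')"
  have weight: "wired_weight q p' E' (B \<union> (E' - E)) = q ^ c * wired_weight q p E B" if "B \<subseteq> E" for B
  proof -
    have "B \<union> (E' - E) \<union> (lattice_edges - E') = B \<union> O'"
      using E' \<open>E \<subseteq> E'\<close> by (auto simp: O'_def)
    then have "wired_clusters E' (B \<union> (E' - E)) = wired_clusters E B + c"
      unfolding wired_clusters_def c_def O'_def[symmetric]
      using clusters_meeting_enlarge[of "\<Union>E'" "\<Union>E" B O'] finite_Union_edges[OF E'] \<open>E \<subseteq> E'\<close> that
      by auto
    moreover have "(\<Prod>e\<in>E'. if e \<in> B \<union> (E' - E) then p' e else 1 - p' e)
        = (\<Prod>e\<in>E. if e \<in> B then p e else 1 - p e)"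
      using E' \<open>E \<subseteq> E'\<close> that by (intro prod.mono_neutral_cong_right) (auto simp: p'_def)
    ultimately show ?thesis
      by (simp add: wired_weight_def power_add)
  qed
  have sums: "(\<Sum>A\<in>Pow E' \<inter> {A. A \<inter> E \<in> D}. wired_weight q p' E' A)
      = q ^ c * (\<Sum>A\<in>Pow E \<inter> D. wired_weight q p E A)" for D
  proof -
    have "(\<Sum>A\<in>Pow E' \<inter> {A. A \<inter> E \<in> D}. wired_weight q p' E' A)
        = (\<Sum>A\<in>(\<lambda>B. B \<union> (E' - E)) ` (Pow E \<inter> D). wired_weight q p' E' A)"
    proof (rule sum.mono_neutral_right)
      show "(\<lambda>B. B \<union> (E' - E)) ` (Pow E \<inter> D) \<subseteq> Pow E' \<inter> {A. A \<inter> E \<in> D}"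
      proof
        fix A
        assume "A \<in> (\<lambda>B. B \<union> (E' - E)) ` (Pow E \<inter> D)"
        then obtain B where B: "B \<subseteq> E" "B \<in> D" "A = B \<union> (E' - E)"
          by auto
        then have "A \<inter> E = B"
          by auto
        then show "A \<in> Pow E' \<inter> {A. A \<inter> E \<in> D}"
          using B \<open>E \<subseteq> E'\<close> by auto
      qed
      show "\<forall>A\<in>Pow E' \<inter> {A. A \<inter> E \<in> D} - (\<lambda>B. B \<union> (E' - E)) ` (Pow E \<inter> D). wired_weight q p' E' A = 0"
      proof
        fix A
        assume A: "A \<in> Pow E' \<inter> {A. A \<inter> E \<in> D} - (\<lambda>B. B \<union> (E' - E)) ` (Pow E \<inter> D)"
        then have "A \<noteq> (A \<inter> E) \<union> (E' - E)"
          by auto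
        then obtain e where "e \<in> E'" "e \<notin> E" "e \<notin> A"
          using A by blast
        then have "(\<Prod>e\<in>E'. if e \<in> A then p' e else 1 - p' e) = 0"
          using E'(1) by (intro prod_zero) (auto simp: p'_def)
        then show "wired_weight q p' E' A = 0"
          by (simp add: wired_weight_def)
      qed
    qed (use E'(1) in auto)
    also have "\<dots> = (\<Sum>B\<in>Pow E \<inter> D. wired_weight q p' E' (B \<union> (E' - E)))"
      by (rule sum.reindex_cong[OF _ refl refl]) (auto simp: inj_on_def)
    also have "\<dots> = q ^ c * (\<Sum>A\<in>Pow E \<inter> D. wired_weight q p E A)"
      unfolding sum_distrib_left by (intro sum.cong) (auto simp: weight)
    finally show ?thesis .
  qed
  have Z: "(\<Sum>A\<in>Pow E'. wired_weight q p' E' A) = q ^ c * (\<Sum>A\<in>Pow E. wired_weight q p E A)"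
    using sums[of UNIV] by simp
  show "wired_prob q p' E' {A. A \<inter> E \<in> D} = wired_prob q p E D"
    unfolding wired_prob_def sums Z using \<open>q \<ge> 1\<close> by simp
  show "\<exists>c>0. (\<Sum>A\<in>Pow E'. wired_weight q p' E' A) = c * (\<Sum>A\<in>Pow E. wired_weight q p E A)"
    using Z \<open>q \<ge> 1\<close> by (intro exI[of _ "q ^ c"]) auto
qed

text \<open>
  Wiring \<open>E' - E\<close> increases edge probabilities, hence makes decreasing events less likely.
\<close>

lemma wired_prob_domain_mono:
  assumes E': "finite E'" "E' \<subseteq> lattice_edges" and "E \<subseteq> E'" and "q \<ge> 1"
    and p: "\<And>e. e \<in> E' \<Longrightarrow> 0 \<le> p e" "\<And>e. e \<in> E' \<Longrightarrow> p e < 1"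
    and D: "decreasing_event D"
  shows "wired_prob q p E D \<le> wired_prob q p E' {A. A \<inter> E \<in> D}"
proof -
  let ?p' = "\<lambda>e. if e \<in> E then p e else 1"
  have "finite E"
    using E' \<open>E \<subseteq> E'\<close> finite_subset by blast
  then have ZE: "0 < (\<Sum>A\<in>Pow E. wired_weight q p E A)"
    using p \<open>E \<subseteq> E'\<close> \<open>q \<ge> 1\<close> by (intro wired_partition_pos) auto
  have "wired_prob q ?p' E' {A. A \<inter> E \<in> D} \<le> wired_prob q p E' {A. A \<inter> E \<in> D}"
  proof (rule wired_prob_antimono)
    show "0 < (\<Sum>A\<in>Pow E'. wired_weight q p E' A)"
      using E' \<open>q \<ge> 1\<close> p by (intro wired_partition_pos)
    show "0 < (\<Sum>A\<in>Pow E'. wired_weight q ?p' E' A)"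
      using wired_prob_enlarge(2)[OF E' \<open>E \<subseteq> E'\<close> \<open>q \<ge> 1\<close>, of p] ZE by auto
    have "B \<inter> E \<in> D" if "A \<inter> E \<in> D" "B \<subseteq> A" for A B
      using D that unfolding decreasing_event_def by (metis Int_mono order_refl)
    then show "decreasing_event {A. A \<inter> E \<in> D}"
      by (auto simp: decreasing_event_def)
  qed (use assms in \<open>auto intro: less_imp_le\<close>)
  then show ?thesis
    by (simp add: wired_prob_enlarge(1)[OF E' \<open>E \<subseteq> E'\<close> \<open>q \<ge> 1\<close>])
qed

subsection \<open>Configurations as sets of open edges\<close>

lemma rc_weight_wired:
  assumes "\<omega> \<in> configs E"
  shows "rc_weight q \<beta> J E wired \<omega> = wired_weight q (\<lambda>e. edge_prob \<beta> (J e)) E {e \<in> E. \<omega> e = 1}"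
proof -
  have "{e \<in> lattice_edges - E. wired e = 1} = lattice_edges - E"
    by (auto simp: wired_def)
  moreover have "(\<Prod>e\<in>E. edge_prob \<beta> (J e) ^ \<omega> e * (1 - edge_prob \<beta> (J e)) ^ (1 - \<omega> e))
     = (\<Prod>e\<in>E. if e \<in> {e \<in> E. \<omega> e = 1} then edge_prob \<beta> (J e) else 1 - edge_prob \<beta> (J e))"
    using assms by (intro prod.cong) (auto simp: configs_def PiE_iff)
  ultimately show ?thesis
    by (simp add: rc_weight_def wired_weight_def num_clusters_def wired_clusters_def clusters_meeting_def)
qed

lemma sum_configs:
  assumes "\<And>\<omega>. \<omega> \<in> configs E \<Longrightarrow> f \<omega> = g {e \<in> E. \<omega> e = 1}"
  shows "(\<Sum>\<omega>\<in>{\<omega> \<in> configs E. {e \<in> E. \<omega> e = 1} \<in> D}. f \<omega>) = (\<Sum>A\<in>Pow E \<inter> D. g A)"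
proof (rule sum.reindex_bij_witness[where
      i = "\<lambda>A. restrict (\<lambda>e. if e \<in> A then 1 else 0) E" and j = "\<lambda>\<omega>. {e \<in> E. \<omega> e = 1}"])
  fix \<omega>
  assume "\<omega> \<in> {\<omega> \<in> configs E. {e \<in> E. \<omega> e = 1} \<in> D}"
  then have \<omega>: "\<omega> \<in> configs E"
    by simp
  show "restrict (\<lambda>e. if e \<in> {e \<in> E. \<omega> e = 1} then 1 else 0) E = \<omega>"
  proof
    fix e
    show "restrict (\<lambda>e. if e \<in> {e \<in> E. \<omega> e = 1} then 1 else 0) E e = \<omega> e"
      using \<omega> by (cases "e \<in> E") (auto simp: configs_def PiE_iff extensional_def)
  qed
next
  fix A
  assume A: "A \<in> Pow E \<inter> D"
  then have *: "{e \<in> E. restrict (\<lambda>e. if e \<in> A then 1 else 0 :: nat) E e = 1} = A"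
    by (auto split: if_splits)
  then show "{e \<in> E. restrict (\<lambda>e. if e \<in> A then 1 else 0 :: nat) E e = 1} = A" .
  show "restrict (\<lambda>e. if e \<in> A then 1 else 0) E \<in> {\<omega> \<in> configs E. {e \<in> E. \<omega> e = 1} \<in> D}"
    using A unfolding mem_Collect_eq * by (auto simp: configs_def)
qed (use assms in auto)

lemma edge_prob_bounds:
  assumes "0 \<le> \<beta> * j"
  shows "0 \<le> edge_prob \<beta> j" "edge_prob \<beta> j < 1"
  using assms by (simp_all add: edge_prob_def)

lemma measure_rc_measure_wired:
  assumes "finite E" "q \<ge> 1" "\<And>e. e \<in> E \<Longrightarrow> 0 \<le> \<beta> * J e"
  shows "measure (rc_measure q \<beta> J E wired) {\<omega> \<in> configs E. {e \<in> E. \<omega> e = 1} \<in> D}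
    = wired_prob q (\<lambda>e. edge_prob \<beta> (J e)) E D"
proof -
  let ?w = "wired_weight q (\<lambda>e. edge_prob \<beta> (J e)) E"
  let ?D = "{\<omega> \<in> configs E. {e \<in> E. \<omega> e = 1} \<in> D}"
  define Z where "Z = (\<Sum>\<omega>\<in>configs E. rc_weight q \<beta> J E wired \<omega>)"
  have fin: "finite (configs E)"
    using \<open>finite E\<close> by (simp add: configs_def finite_PiE)
  have Z: "Z = (\<Sum>A\<in>Pow E. ?w A)"
    using sum_configs[of E "rc_weight q \<beta> J E wired" ?w UNIV] by (simp add: Z_def rc_weight_wired)
  have "0 \<le> ?w A" for A
    using assms edge_prob_bounds by (intro wired_weight_nonneg) (auto intro: less_imp_le)
  then have nonneg: "0 \<le> rc_weight q \<beta> J E wired \<omega> / Z" if "\<omega> \<in> configs E" for \<omega>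
    unfolding Z using that by (auto intro!: divide_nonneg_nonneg sum_nonneg simp: rc_weight_wired)
  have "emeasure (rc_measure q \<beta> J E wired) ?D = (\<Sum>\<omega>\<in>?D. ennreal (rc_weight q \<beta> J E wired \<omega> / Z))"
    unfolding rc_measure_def Z_def using fin by (intro emeasure_point_measure_finite) auto
  also have "\<dots> = ennreal (\<Sum>\<omega>\<in>?D. rc_weight q \<beta> J E wired \<omega> / Z)"
    using nonneg by (intro sum_ennreal) auto
  finally have "measure (rc_measure q \<beta> J E wired) ?D = (\<Sum>\<omega>\<in>?D. rc_weight q \<beta> J E wired \<omega> / Z)"
    unfolding measure_def using nonneg by (simp only:) (rule enn2real_ennreal, auto intro!: sum_nonneg)
  also have "\<dots> = (\<Sum>\<omega>\<in>?D. rc_weight q \<beta> J E wired \<omega>) / Z"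
    by (simp add: sum_divide_distrib)
  also have "(\<Sum>\<omega>\<in>?D. rc_weight q \<beta> J E wired \<omega>) = (\<Sum>A\<in>Pow E \<inter> D. ?w A)"
    by (rule sum_configs) (rule rc_weight_wired)
  finally show ?thesis
    by (simp add: wired_prob_def Z)
qed

section \<open>Discretized rectangles\<close>

lemma edges_in_lattice: "V \<subseteq> int_lattice \<Longrightarrow> edges_in V \<subseteq> lattice_edges"
  by (auto simp: edges_in_def)

lemma edges_in_mono: "V \<subseteq> V' \<Longrightarrow> edges_in V \<subseteq> edges_in V'"
  by (auto simp: edges_in_def)

lemma finite_edges_in: "finite V \<Longrightarrow> finite (edges_in V)"
  by (rule finite_subset[of _ "(\<lambda>(x, y). {x, y}) ` (V \<times> V)"]) (auto simp: edges_in_def)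

lemma int_lattice_diff: "x \<in> int_lattice \<Longrightarrow> y \<in> int_lattice \<Longrightarrow> x - y \<in> int_lattice"
  by (simp add: int_lattice_def)

lemma finite_int_lattice_bounded:
  fixes B :: "(real ^ 'd) set"
  assumes "bounded B"
  shows "finite (int_lattice \<inter> B)"
proof -
  obtain a where a: "\<And>y. y \<in> B \<Longrightarrow> norm y \<le> a"
    using assms by (auto simp: bounded_iff)
  let ?box = "\<Pi>\<^sub>E i\<in>(UNIV :: 'd set). {- \<lceil>a\<rceil>..\<lceil>a\<rceil>}"
  have "int_lattice \<inter> B \<subseteq> (\<lambda>f. \<chi> i. of_int (f i)) ` ?box"
  proof
    fix y :: "real ^ 'd"
    assume y: "y \<in> int_lattice \<inter> B"
    have "\<lfloor>y $ i\<rfloor> \<in> {- \<lceil>a\<rceil>..\<lceil>a\<rceil>}" for i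
      using component_le_norm_cart[of y i] a[of y] y by (simp, linarith)
    moreover have "y = (\<chi> i. of_int \<lfloor>y $ i\<rfloor>)"
      using y by (simp add: vec_eq_iff int_lattice_def)
    ultimately show "y \<in> (\<lambda>f. \<chi> i. of_int (f i)) ` ?box"
      by (intro image_eqI[of _ _ "\<lambda>i. \<lfloor>y $ i\<rfloor>"]) auto
  qed
  moreover have "finite ?box"
    by (intro finite_PiE) auto
  ultimately show ?thesis
    using finite_surj by blast
qed

text \<open>
  An edge is determined by one endpoint in \<open>V\<close> and by the difference of the endpoints, which is a
  lattice point of the unit ball.
\<close>

lemma card_edges_in_le:
  fixes V :: "(real ^ 'd) set"
  assumes "finite V" "V \<subseteq> int_lattice"
  shows "card (edges_in V) \<le> card V * card (int_lattice \<inter> cball (0 :: real ^ 'd) 1)"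
proof -
  let ?K = "int_lattice \<inter> cball (0 :: real ^ 'd) 1"
  have fin: "finite (V \<times> ?K)"
    using assms finite_int_lattice_bounded[of "cball (0 :: real ^ 'd) 1"] by auto
  have "edges_in V \<subseteq> (\<lambda>(y, u). {y, y + u}) ` (V \<times> ?K)"
  proof
    fix e
    assume "e \<in> edges_in V"
    then obtain y z where "y \<in> V" "z \<in> V" "norm (y - z) = 1" "e = {y, z}"
      by (auto simp: edges_in_def)
    then show "e \<in> (\<lambda>(y, u). {y, y + u}) ` (V \<times> ?K)"
      using assms(2) by (intro image_eqI[of _ _ "(y, z - y)"])
        (auto simp: norm_minus_commute intro: int_lattice_diff)
  qed
  then have "card (edges_in V) \<le> card (V \<times> ?K)"
    using fin by (meson surj_card_le)
  then show ?thesis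
    by (simp add: card_cartesian_product)
qed

text \<open>
  The point is that a slab of bounded width orthogonal to \<open>n\<close> contains only order \<open>a\<close> to the power
  \<open>d - 1\<close> lattice points of a box of side \<open>2 * a\<close>, uniformly in \<open>n\<close>. Some coordinate of the unit vector \<open>n\<close>
  satisfies \<open>\<bar>n $ i\<bar> \<ge> 1 / sqrt d\<close>. Two lattice points that differ only in coordinate \<open>i\<close> then have
  heights \<open>(y - x) \<bullet> n\<close> that are at least \<open>1 / sqrt d\<close> apart. So a lattice point is determined
  by its other \<open>d - 1\<close> coordinates and by the integer part of \<open>sqrt d\<close> times its height.
\<close>

lemma card_lattice_slab_le:
  fixes n x :: "real ^ 'd"
  assumes "norm n = 1" and V: "V \<subseteq> int_lattice" "finite V"
    and slab: "\<And>y. y \<in> V \<Longrightarrow> \<bar>(y - x) \<bullet> n\<bar> \<le> h" and box: "\<And>y i. y \<in> V \<Longrightarrow> \<bar>(y - x) $ i\<bar> \<le> a"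
    and "0 \<le> h" "0 \<le> a"
  shows "real (card V) \<le> (2 * sqrt CARD('d) * h + 3) * (2 * a + 2) ^ (CARD('d) - 1)"
proof -
  define r where "r = sqrt (real CARD('d))"
  have "r > 0" "r\<^sup>2 = CARD('d)"
    by (simp_all add: r_def)
  obtain i where i: "1 \<le> r * \<bar>n $ i\<bar>"
  proof (rule ccontr)
    assume "\<not> thesis"
    then have "r * \<bar>n $ i\<bar> < 1" for i
      using that[of i] by (meson not_le)
    then have "(r * \<bar>n $ i\<bar>)\<^sup>2 < 1" for i
      using \<open>r > 0\<close> by (intro power_less_one_iff[THEN iffD2]) auto
    then have "r\<^sup>2 * (n $ i)\<^sup>2 < 1" for i
      by (simp add: power_mult_distrib)
    then have "(\<Sum>i\<in>UNIV. r\<^sup>2 * (n $ i)\<^sup>2) < (\<Sum>i\<in>(UNIV :: 'd set). 1)"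
      by (intro sum_strict_mono) auto
    moreover have "(\<Sum>i\<in>UNIV. (n $ i)\<^sup>2) = 1"
      using \<open>norm n = 1\<close> by (simp add: norm_vec_def L2_set_def)
    ultimately show False
      using \<open>r\<^sup>2 = CARD('d)\<close> by (simp flip: sum_distrib_left)
  qed
  \<comment> \<open>The box \<open>T\<close> contains the integer data \<open>\<phi> y\<close> that determine a point \<open>y\<close> of \<open>V\<close>.\<close>
  define \<phi> where "\<phi> y j = (if j = i then \<lfloor>r * ((y - x) \<bullet> n)\<rfloor> else \<lfloor>y $ j\<rfloor>)" for y j
  define T where "T j = (if j = i then {- \<lceil>r * h\<rceil>..\<lceil>r * h\<rceil>} else {\<lfloor>x $ j - a\<rfloor>..\<lfloor>x $ j + a\<rfloor>})" for j
  have "inj_on \<phi> V"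
  proof
    fix y z
    assume yz: "y \<in> V" "z \<in> V" and eq: "\<phi> y = \<phi> z"
    have ints: "y $ j \<in> \<int>" "z $ j \<in> \<int>" for j
      using yz V(1) by (auto simp: int_lattice_def)
    have off: "y $ j = z $ j" if "j \<noteq> i" for j
      using fun_cong[OF eq, of j] that ints[of j] by (auto simp: \<phi>_def elim!: Ints_cases)
    have "(y - z) \<bullet> n = (\<Sum>j\<in>UNIV. (y $ j - z $ j) * n $ j)"
      by (simp add: inner_vec_def)
    also have "\<dots> = (y $ i - z $ i) * n $ i"
      by (subst sum.remove[of _ i]) (auto simp: off)
    finally have "r * ((y - z) \<bullet> n) = (y $ i - z $ i) * (r * n $ i)"
      by simp
    then have "r * ((y - x) \<bullet> n) - r * ((z - x) \<bullet> n) = (y $ i - z $ i) * (r * n $ i)"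
      by (simp add: inner_diff_left right_diff_distrib)
    moreover have "\<bar>r * ((y - x) \<bullet> n) - r * ((z - x) \<bullet> n)\<bar> < 1"
      using fun_cong[OF eq, of i] by (simp add: \<phi>_def) linarith
    ultimately have "\<bar>y $ i - z $ i\<bar> * (r * \<bar>n $ i\<bar>) < 1"
      using \<open>r > 0\<close> by (simp add: abs_mult)
    moreover have "\<bar>y $ i - z $ i\<bar> * 1 \<le> \<bar>y $ i - z $ i\<bar> * (r * \<bar>n $ i\<bar>)"
      using i by (intro mult_left_mono) auto
    ultimately have "\<bar>y $ i - z $ i\<bar> < 1"
      by simp
    then have "y $ i = z $ i"
      using ints[of i] by (auto elim!: Ints_cases simp flip: of_int_diff of_int_abs)
    then show "y = z"
      using off by (metis vec_eq_iff)
  qed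
  moreover have "\<phi> ` V \<subseteq> PiE UNIV T"
  proof (intro image_subsetI PiE_I)
    fix y j
    assume "y \<in> V"
    have "\<bar>r * ((y - x) \<bullet> n)\<bar> \<le> r * h"
      using slab[OF \<open>y \<in> V\<close>] \<open>r > 0\<close> by (simp add: abs_mult)
    moreover have "\<bar>y $ j - x $ j\<bar> \<le> a"
      using box[OF \<open>y \<in> V\<close>, of j] by simp
    ultimately show "\<phi> y j \<in> T j"
      unfolding \<phi>_def T_def by (auto intro!: floor_mono) linarith+
  qed auto
  moreover have "finite (PiE UNIV T)"
    by (intro finite_PiE) (auto simp: T_def)
  ultimately have "card V \<le> card (PiE UNIV T)"
    by (metis card_inj_on_le)
  also have "card (PiE UNIV T) = (\<Prod>j\<in>UNIV. card (T j))"
    by (simp add: card_PiE)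
  also have "\<dots> = card (T i) * (\<Prod>j\<in>UNIV - {i}. card (T j))"
    by (rule prod.remove) auto
  finally have "real (card V) \<le> real (card (T i)) * (\<Prod>j\<in>UNIV - {i}. real (card (T j)))"
    by (metis of_nat_le_iff of_nat_mult of_nat_prod)
  also have "\<dots> \<le> (2 * r * h + 3) * (\<Prod>j\<in>UNIV - {i}. 2 * a + 2)"
  proof (intro mult_mono prod_mono conjI)
    have "0 \<le> r * h"
      using \<open>r > 0\<close> \<open>0 \<le> h\<close> by simp
    then show "real (card (T i)) \<le> 2 * r * h + 3"
      by (simp add: T_def) linarith
    show "0 \<le> 2 * r * h + 3"
      using \<open>0 \<le> r * h\<close> by simp
    show "real (card (T j)) \<le> 2 * a + 2" if "j \<in> UNIV - {i}" for j
      using that \<open>0 \<le> a\<close> by (simp add: T_def) linarith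
  qed (auto intro: prod_nonneg)
  finally show ?thesis
    by (simp add: r_def card_Diff_singleton)
qed

text \<open>
  The points of the cube are sums of at most \<open>d\<close> vectors of norm at most \<open>1 / 2\<close> orthogonal to \<open>n\<close>.
\<close>

lemma unit_cube_inner_norm:
  fixes n s :: "real ^ 'd"
  assumes "S \<in> unit_cubes n" "s \<in> S"
  shows "s \<bullet> n = 0" "norm s \<le> CARD('d) / 2"
proof -
  obtain U t where U: "n \<notin> U" "orthonormal_basis (insert n U)" and s: "s = (\<Sum>u\<in>U. t u *\<^sub>R u)"
    and t: "\<And>u. u \<in> U \<Longrightarrow> t u \<in> {-1/2..1/2}"
    using assms by (auto simp: unit_cubes_def)
  have orth: "pairwise orthogonal (insert n U)" and unit: "\<And>u. u \<in> U \<Longrightarrow> norm u = 1"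
    using U(2) by (auto simp: orthonormal_basis_def)
  have "u \<bullet> n = 0" if "u \<in> U" for u
    using orth U(1) that by (auto simp: pairwise_insert orthogonal_def)
  then show "s \<bullet> n = 0"
    by (simp add: s inner_sum_left)
  have "independent U"
    using orth unit by (intro pairwise_orthogonal_independent) (force simp: pairwise_insert)+
  then have U_card: "finite U" "card U \<le> CARD('d)"
    using independent_bound[of U] by auto
  have "norm s \<le> (\<Sum>u\<in>U. norm (t u *\<^sub>R u))"
    unfolding s by (rule norm_sum)
  also have "\<dots> \<le> (\<Sum>u\<in>U. 1 / 2)"
    using t unit by (intro sum_mono) (force simp: abs_le_iff)
  also have "\<dots> \<le> CARD('d) / 2"
    using U_card by simp
  finally show "norm s \<le> CARD('d) / 2" .
qed

lemma rect_iff: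
  "y \<in> rect x L H S n \<longleftrightarrow> (\<exists>s\<in>S. \<exists>h. \<bar>h\<bar> \<le> H \<and> y = x + L *\<^sub>R s + h *\<^sub>R n)"
  unfolding rect_def abs_le_iff by (force simp: minus_le_iff)

lemma rect_height_norm:
  fixes n x :: "real ^ 'd"
  assumes "S \<in> unit_cubes n" "norm n = 1" "0 \<le> L" "y \<in> rect x L H S n"
  shows "\<bar>(y - x) \<bullet> n\<bar> \<le> H" "norm (y - x) \<le> L * (CARD('d) / 2) + H"
proof -
  obtain s h where sh: "s \<in> S" "\<bar>h\<bar> \<le> H" "y = x + L *\<^sub>R s + h *\<^sub>R n"
    using assms(4) by (auto simp: rect_iff)
  have "n \<bullet> n = 1"
    using assms(2) by (simp add: dot_square_norm)
  then show "\<bar>(y - x) \<bullet> n\<bar> \<le> H"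
    using sh unit_cube_inner_norm(1)[OF assms(1) sh(1)] by (simp add: inner_add_left)
  have "norm (y - x) \<le> norm (L *\<^sub>R s) + norm (h *\<^sub>R n)"
    using norm_triangle_ineq[of "L *\<^sub>R s" "h *\<^sub>R n"] sh(3) by (simp add: add.assoc)
  also have "\<dots> \<le> L * (CARD('d) / 2) + H"
    using sh(2) mult_left_mono[OF unit_cube_inner_norm(2)[OF assms(1) sh(1)] \<open>0 \<le> L\<close>] assms(2,3)
    by simp
  finally show "norm (y - x) \<le> L * (CARD('d) / 2) + H" .
qed

lemma discretize_subset: "discretize R \<subseteq> int_lattice" "discretize R \<subseteq> R"
  using interior_subset by (auto simp: discretize_def)

lemma finite_discretize_rect:
  fixes n x :: "real ^ 'd"
  assumes "S \<in> unit_cubes n" "norm n = 1" "0 \<le> L"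
  shows "finite (discretize (rect x L H S n))"
proof -
  have "rect x L H S n \<subseteq> cball x (L * (CARD('d) / 2) + H)"
    using rect_height_norm(2)[OF assms] by (auto simp: dist_norm norm_minus_commute)
  then have "bounded (rect x L H S n)"
    using bounded_cball bounded_subset by blast
  then have "finite (int_lattice \<inter> rect x L H S n)"
    by (rule finite_int_lattice_bounded)
  then show ?thesis
    by (rule finite_subset[rotated]) (use discretize_subset in blast)
qed

lemma edges_in_rect:
  fixes n x :: "real ^ 'd"
  assumes "S \<in> unit_cubes n" "norm n = 1" "0 \<le> L"
  shows "finite (edges_in (discretize (rect x L H S n)))"
    and "edges_in (discretize (rect x L H S n)) \<subseteq> lattice_edges"
  using finite_edges_in[OF finite_discretize_rect[OF assms]] edges_in_lattice[OF discretize_subset(1)]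
  by blast+

lemma discretize_rect_mono: "H \<le> H' \<Longrightarrow> discretize (rect x L H S n) \<subseteq> discretize (rect x L H' S n)"
  unfolding discretize_def by (intro Int_mono interior_mono order_refl) (force simp: rect_iff)

text \<open>
  Increasing \<open>H\<close> adds points only at heights at least \<open>H\<close>: intersecting the interior of the larger
  rectangle with the open slab of half-width \<open>H\<close> gives an open subset of the smaller rectangle.
\<close>

lemma discretize_rect_height:
  fixes n x :: "real ^ 'd"
  assumes "S \<in> unit_cubes n" "norm n = 1"
    and y: "y \<in> discretize (rect x L H' S n)" "y \<notin> discretize (rect x L H S n)"
  shows "H \<le> \<bar>(y - x) \<bullet> n\<bar>"
proof (rule ccontr)
  assume "\<not> H \<le> \<bar>(y - x) \<bullet> n\<bar>"
  let ?O = "interior (rect x L H' S n) \<inter> {z. \<bar>(z - x) \<bullet> n\<bar> < H}"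
  have "n \<bullet> n = 1"
    using assms(2) by (simp add: dot_square_norm)
  have "?O \<subseteq> rect x L H S n"
  proof
    fix z
    assume z: "z \<in> ?O"
    then obtain s h where sh: "s \<in> S" "z = x + L *\<^sub>R s + h *\<^sub>R n"
      using interior_subset[of "rect x L H' S n"] by (metis IntD1 rect_iff subsetD)
    then have "(z - x) \<bullet> n = h"
      using unit_cube_inner_norm(1)[OF assms(1) sh(1)] \<open>n \<bullet> n = 1\<close> by (simp add: inner_add_left)
    then show "z \<in> rect x L H S n"
      unfolding rect_iff using z sh by (intro bexI[of _ s] exI[of _ h]) auto
  qed
  moreover have "open ?O"
    by (intro open_Int open_interior open_Collect_less continuous_intros)
  ultimately have "?O \<subseteq> interior (rect x L H S n)"
    by (rule interior_maximal)
  then show False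
    using y \<open>\<not> H \<le> \<bar>(y - x) \<bullet> n\<bar>\<close> by (auto simp: discretize_def)
qed

section \<open>Separation of the two halves of the boundary\<close>

definition separating :: "real ^ 'd \<Rightarrow> real ^ 'd \<Rightarrow> (real ^ 'd) set \<Rightarrow> (real ^ 'd) set set set" where
  "separating x n V = {A. \<forall>y\<in>upper_boundary x n V. \<forall>z\<in>lower_boundary x n V. (y, z) \<notin> linked A}"

lemma disconnection_eq_separating:
  "disconnection x n V
    = {\<omega> \<in> configs (edges_in V). {e \<in> edges_in V. \<omega> e = 1} \<in> separating x n V}"
  by (auto simp: disconnection_def separating_def)

lemma decreasing_event_separating: "decreasing_event (separating x n V)"
  unfolding decreasing_event_def separating_def using linked_mono by blast

lemma empty_in_separating: "{} \<in> separating x n V"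
  by (auto simp: separating_def linked_def upper_boundary_def lower_boundary_def)

text \<open>
  Every open path that joins the two halves of the boundary of the larger domain \<open>V'\<close> contains a
  piece inside \<open>V\<close> that joins the two halves of the boundary of \<open>V\<close>. To see this, follow the path
  from its upper endpoint. As long as no such piece has occurred, the path is either outside \<open>V\<close> at
  nonnegative height, or inside \<open>V\<close> and linked within \<open>V\<close> to the upper boundary of \<open>V\<close>. Indeed, it
  enters and leaves \<open>V\<close> through its inner boundary, and outside \<open>V\<close> the height exceeds \<open>1\<close> in
  absolute value, so a step of length \<open>1\<close> to or from such a point cannot change the sign of
  the height. The lower endpoint of the path satisfies neither alternative.
\<close>

lemma separating_enlarge:
  assumes "V \<subseteq> V'" "V' \<subseteq> int_lattice" "norm n = 1" "1 < H"
    and outside: "\<And>y. y \<in> V' \<Longrightarrow> y \<notin> V \<Longrightarrow> H \<le> \<bar>(y - x) \<bullet> n\<bar>"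
    and A: "A \<subseteq> edges_in V'" "A \<inter> edges_in V \<in> separating x n V"
  shows "A \<in> separating x n V'"
  unfolding separating_def
proof (intro CollectI ballI notI)
  fix y0 z0
  assume y0: "y0 \<in> upper_boundary x n V'" and z0: "z0 \<in> lower_boundary x n V'"
    and "(y0, z0) \<in> linked A"
  let ?h = "\<lambda>y. (y - x) \<bullet> n"
  let ?linked_up = "\<lambda>y. \<exists>u\<in>upper_boundary x n V. (u, y) \<in> linked (A \<inter> edges_in V)"
  have sep: False if "?linked_up y" "y \<in> lower_boundary x n V" for y
    using A(2) that by (auto simp: separating_def)
  from \<open>(y0, z0) \<in> linked A\<close> have "(y0, z0) \<in> {(x, y). {x, y} \<in> A}\<^sup>*"
    by (simp add: linked_def)
  then have "z0 \<in> V' \<and> (if z0 \<in> V then ?linked_up z0 else 0 \<le> ?h z0)"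
  proof (induction rule: rtrancl_induct)
    case base
    have "y0 \<in> upper_boundary x n V" if "y0 \<in> V"
      using y0 that \<open>V \<subseteq> V'\<close> by (auto simp: upper_boundary_def inner_boundary_def)
    moreover have "y0 \<in> V'" "0 \<le> ?h y0"
      using y0 by (auto simp: upper_boundary_def inner_boundary_def)
    ultimately show ?case
      by (auto intro: linked_refl)
  next
    case (step y z)
    then have "{y, z} \<in> edges_in V'"
      using A(1) by auto
    then have yz: "y \<in> V'" "z \<in> V'" "norm (y - z) = 1" "norm (z - y) = 1"
      by (auto simp: edges_in_def doubleton_eq_iff norm_minus_commute)
    have "\<bar>?h z - ?h y\<bar> = \<bar>(z - y) \<bullet> n\<bar>"
      by (simp add: inner_diff_left)
    also have "\<dots> \<le> 1"
      using Cauchy_Schwarz_ineq2[of "z - y" n] yz \<open>norm n = 1\<close> by simp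
    finally have h: "\<bar>?h z - ?h y\<bar> \<le> 1" .
    consider "y \<in> V" "z \<in> V" | "y \<in> V" "z \<notin> V" | "y \<notin> V" "z \<in> V" | "y \<notin> V" "z \<notin> V"
      by blast
    then show ?case
    proof cases
      case 1
      then have "{y, z} \<in> edges_in V"
        using yz by (auto simp: edges_in_def)
      then have "(y, z) \<in> linked (A \<inter> edges_in V)"
        using step.hyps by (intro linked_edge) auto
      then show ?thesis
        using 1 step.IH yz by (auto intro: linked_trans)
    next
      case 2
      then have "y \<in> inner_boundary V"
        using yz \<open>V' \<subseteq> int_lattice\<close> by (auto simp: inner_boundary_def)
      then have "0 \<le> ?h y"
        using 2 step.IH sep[of y] by (force simp: lower_boundary_def)
      then show ?thesis
        using 2 h outside[of z] yz \<open>1 < H\<close> by auto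
    next
      case 3
      then have "z \<in> inner_boundary V"
        using yz \<open>V' \<subseteq> int_lattice\<close> by (auto simp: inner_boundary_def)
      moreover have "0 \<le> ?h z"
        using 3 step.IH h outside[of y] yz \<open>1 < H\<close> by auto
      ultimately have "z \<in> upper_boundary x n V"
        by (simp add: upper_boundary_def)
      then show ?thesis
        using 3 yz by (auto intro: linked_refl)
    next
      case 4
      then show ?thesis
        using step.IH h outside[of z] outside[of y] yz \<open>1 < H\<close> by auto
    qed
  qed
  moreover have "?h z0 < 0" "z0 \<in> V \<Longrightarrow> z0 \<in> lower_boundary x n V"
    using z0 \<open>V \<subseteq> V'\<close> by (auto simp: lower_boundary_def inner_boundary_def)
  ultimately show False
    using sep[of z0] by (auto split: if_splits)
qed

section \<open>Monotonicity of the surface tension\<close>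

lemma surface_tension_eq:
  fixes n x :: "real ^ 'd"
  assumes "S \<in> unit_cubes n" "norm n = 1" "0 \<le> L" "q \<ge> 1" "\<And>e. e \<in> lattice_edges \<Longrightarrow> 0 \<le> \<beta> * J e"
  shows "surface_tension q \<beta> J x L H S n = - (1 / L ^ (CARD('d) - 1)) *
    ln (wired_prob q (\<lambda>e. edge_prob \<beta> (J e)) (edges_in (discretize (rect x L H S n)))
      (separating x n (discretize (rect x L H S n))))"
proof -
  show ?thesis
    using edges_in_rect[OF assms(1-3), of x H]
    unfolding surface_tension_def Let_def disconnection_eq_separating
    using assms(4,5) by (subst measure_rc_measure_wired) auto
qed

lemma wired_prob_le_1:
  assumes "finite E" "q \<ge> 1" "\<And>e. e \<in> E \<Longrightarrow> 0 \<le> p e" "\<And>e. e \<in> E \<Longrightarrow> p e < 1"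
  shows "wired_prob q p E D \<le> 1"
proof -
  have "0 \<le> wired_weight q p E A" for A
    using assms by (intro wired_weight_nonneg) (auto intro: less_imp_le)
  then have "(\<Sum>A\<in>Pow E \<inter> D. wired_weight q p E A) \<le> (\<Sum>A\<in>Pow E. wired_weight q p E A)"
    using assms(1) by (intro sum_mono2) auto
  then show ?thesis
    unfolding wired_prob_def using wired_partition_pos[OF assms] by (simp add: divide_le_eq_1)
qed

lemma wired_prob_pos:
  assumes "finite E" "E \<subseteq> lattice_edges" "q \<ge> 1"
    and "\<And>e. e \<in> E \<Longrightarrow> 0 \<le> p e" "\<And>e. e \<in> E \<Longrightarrow> p e < 1" and "{} \<in> D"
  shows "0 < wired_prob q p E D"
proof -
  have "0 < (\<Prod>e\<in>E. 1 - p e)"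
    using assms(5) by (intro prod_pos) auto
  also have "\<dots> \<le> wired_prob q p E D"
    using assms by (rule prod_closed_le_wired_prob)
  finally show ?thesis .
qed

lemma edge_prob_mono: "\<beta> * j \<le> \<beta>' * j' \<Longrightarrow> edge_prob \<beta> j \<le> edge_prob \<beta>' j'"
  by (simp add: edge_prob_def)

lemma neg_ln_scaled_mono:
  fixes a :: real
  assumes "0 < u" "u \<le> v" "0 \<le> a"
  shows "- a * ln v \<le> - a * ln u"
  using assms by (simp add: mult_left_mono)

context
  fixes n x :: "real ^ 'd" and S :: "(real ^ 'd) set" and L q :: real
  assumes cube: "S \<in> unit_cubes n" "norm n = 1" and "0 \<le> L" and "q \<ge> 1"
begin

lemma surface_tension_mono:
  assumes J: "\<And>e. e \<in> lattice_edges \<Longrightarrow> 0 \<le> \<beta> * J e"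
    and J': "\<And>e. e \<in> lattice_edges \<Longrightarrow> \<beta> * J e \<le> \<beta>' * J' e"
  shows "surface_tension q \<beta> J x L H S n \<le> surface_tension q \<beta>' J' x L H S n"
proof -
  let ?V = "discretize (rect x L H S n)"
  have E: "finite (edges_in ?V)" "edges_in ?V \<subseteq> lattice_edges"
    using edges_in_rect[OF cube \<open>0 \<le> L\<close>] by blast+
  have nonneg: "0 \<le> \<beta>' * J' e" if "e \<in> lattice_edges" for e
    using J[OF that] J'[OF that] by linarith
  have "wired_prob q (\<lambda>e. edge_prob \<beta>' (J' e)) (edges_in ?V) (separating x n ?V)
      \<le> wired_prob q (\<lambda>e. edge_prob \<beta> (J e)) (edges_in ?V) (separating x n ?V)"
    using E J J' nonneg \<open>q \<ge> 1\<close>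
    by (intro wired_prob_antimono decreasing_event_separating wired_partition_pos edge_prob_mono
        edge_prob_bounds less_imp_le[OF edge_prob_bounds(2)]) auto
  moreover have "0 < wired_prob q (\<lambda>e. edge_prob \<beta>' (J' e)) (edges_in ?V) (separating x n ?V)"
    using E nonneg \<open>q \<ge> 1\<close> edge_prob_bounds by (intro wired_prob_pos empty_in_separating) auto
  ultimately show ?thesis
    using neg_ln_scaled_mono[of _ _ "1 / L ^ (CARD('d) - 1)"] J nonneg cube \<open>0 \<le> L\<close> \<open>q \<ge> 1\<close>
    by (simp only: surface_tension_eq) simp
qed

text \<open>
  Raising \<open>H\<close> enlarges the domain, which weakens the wiring and makes disconnection in the small
  rectangle more likely; disconnection in the small rectangle implies disconnection in the large
  one.
\<close>

lemma surface_tension_antimono_height: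
  assumes J: "\<And>e. e \<in> lattice_edges \<Longrightarrow> 0 \<le> \<beta> * J e" and "1 < H" "H \<le> H'"
  shows "surface_tension q \<beta> J x L H' S n \<le> surface_tension q \<beta> J x L H S n"
proof -
  let ?V = "discretize (rect x L H S n)" and ?V' = "discretize (rect x L H' S n)"
  let ?P = "wired_prob q (\<lambda>e. edge_prob \<beta> (J e))"
  have E: "finite (edges_in ?V)" "finite (edges_in ?V')"
      "edges_in ?V \<subseteq> lattice_edges" "edges_in ?V' \<subseteq> lattice_edges"
    using edges_in_rect[OF cube \<open>0 \<le> L\<close>] by blast+
  have V: "?V \<subseteq> ?V'"
    using \<open>H \<le> H'\<close> by (rule discretize_rect_mono)
  have p: "0 \<le> edge_prob \<beta> (J e)" "edge_prob \<beta> (J e) < 1" if "e \<in> lattice_edges" for e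
    using edge_prob_bounds J[OF that] by auto
  have "?P (edges_in ?V) (separating x n ?V)
      \<le> ?P (edges_in ?V') {A. A \<inter> edges_in ?V \<in> separating x n ?V}"
    using E p \<open>q \<ge> 1\<close>
    by (intro wired_prob_domain_mono decreasing_event_separating edges_in_mono[OF V]) auto
  also have "\<dots> \<le> ?P (edges_in ?V') (separating x n ?V')"
  proof -
    let ?w = "wired_weight q (\<lambda>e. edge_prob \<beta> (J e)) (edges_in ?V')"
    have "0 \<le> ?w A" for A
      using p(1) less_imp_le[OF p(2)] E \<open>q \<ge> 1\<close> by (intro wired_weight_nonneg) auto
    moreover have "Pow (edges_in ?V') \<inter> {A. A \<inter> edges_in ?V \<in> separating x n ?V}
        \<subseteq> Pow (edges_in ?V') \<inter> separating x n ?V'"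
      using separating_enlarge[OF V discretize_subset(1) cube(2) \<open>1 < H\<close>] discretize_rect_height[OF cube]
      by blast
    moreover have "0 \<le> (\<Sum>A\<in>Pow (edges_in ?V'). ?w A)"
      using calculation(1) by (rule sum_nonneg)
    ultimately show ?thesis
      unfolding wired_prob_def using E by (intro divide_right_mono sum_mono2) auto
  qed
  finally have "?P (edges_in ?V) (separating x n ?V) \<le> ?P (edges_in ?V') (separating x n ?V')" .
  moreover have "0 < ?P (edges_in ?V) (separating x n ?V)"
    using E p \<open>q \<ge> 1\<close> by (intro wired_prob_pos empty_in_separating) auto
  ultimately show ?thesis
    using neg_ln_scaled_mono[of _ _ "1 / L ^ (CARD('d) - 1)"] J cube \<open>0 \<le> L\<close> \<open>q \<ge> 1\<close>
    by (simp only: surface_tension_eq) simp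
qed

lemma surface_tension_nonneg:
  assumes J: "\<And>e. e \<in> lattice_edges \<Longrightarrow> 0 \<le> \<beta> * J e"
  shows "0 \<le> surface_tension q \<beta> J x L H S n"
proof -
  let ?V = "discretize (rect x L H S n)"
  let ?P = "wired_prob q (\<lambda>e. edge_prob \<beta> (J e)) (edges_in ?V) (separating x n ?V)"
  have E: "finite (edges_in ?V)" "edges_in ?V \<subseteq> lattice_edges"
    using edges_in_rect[OF cube \<open>0 \<le> L\<close>] by blast+
  have p: "0 \<le> edge_prob \<beta> (J e)" "edge_prob \<beta> (J e) < 1" if "e \<in> lattice_edges" for e
    using edge_prob_bounds J[OF that] by auto
  have "?P \<le> 1"
    using E p \<open>q \<ge> 1\<close> by (intro wired_prob_le_1) auto
  moreover have "0 < ?P"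
    using E p \<open>q \<ge> 1\<close> by (intro wired_prob_pos empty_in_separating) auto
  ultimately have "ln ?P \<le> 0"
    by simp
  then show ?thesis
    using \<open>0 \<le> L\<close> J cube \<open>q \<ge> 1\<close> by (subst surface_tension_eq) (auto intro!: divide_nonpos_nonneg)
qed

text \<open>
  Closing all edges of the rectangle disconnects the two halves of its boundary, at a cost of
  \<open>\<beta> * j\<close> for each edge.
\<close>

lemma surface_tension_const_le:
  assumes "0 \<le> \<beta> * j"
  shows "surface_tension q \<beta> (\<lambda>_. j) x L H S n
    \<le> \<beta> * j * card (edges_in (discretize (rect x L H S n))) / L ^ (CARD('d) - 1)"
proof -
  let ?V = "discretize (rect x L H S n)"
  let ?P = "wired_prob q (\<lambda>e. edge_prob \<beta> j) (edges_in ?V) (separating x n ?V)"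
  have E: "finite (edges_in ?V)" "edges_in ?V \<subseteq> lattice_edges"
    using edges_in_rect[OF cube \<open>0 \<le> L\<close>] by blast+
  have "(\<Prod>e\<in>edges_in ?V. 1 - edge_prob \<beta> j) \<le> ?P"
    using E edge_prob_bounds[OF assms] \<open>q \<ge> 1\<close>
    by (intro prod_closed_le_wired_prob empty_in_separating) auto
  moreover have "(\<Prod>e\<in>edges_in ?V. 1 - edge_prob \<beta> j) = exp (- (\<beta> * j * card (edges_in ?V)))"
    by (simp add: edge_prob_def mult.commute flip: exp_of_nat_mult)
  ultimately have "exp (- (\<beta> * j * card (edges_in ?V))) \<le> ?P"
    by simp
  then have "- (\<beta> * j * card (edges_in ?V)) \<le> ln ?P"
    using ln_mono[of "exp (- (\<beta> * j * card (edges_in ?V)))" ?P] by (simp add: order.strict_trans2)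
  then have "- ln ?P / L ^ (CARD('d) - 1) \<le> \<beta> * j * card (edges_in ?V) / L ^ (CARD('d) - 1)"
    using \<open>0 \<le> L\<close> by (intro divide_right_mono) auto
  then show ?thesis
    using \<open>0 \<le> L\<close> assms cube \<open>q \<ge> 1\<close> by (subst surface_tension_eq) auto
qed

end

text \<open>
  The factors come from the height window, from the other coordinates, and from the number
  of possible differences between the endpoints of an edge.
\<close>

definition edge_count_const :: "'d::finite itself \<Rightarrow> real" where
  "edge_count_const _ = (4 * CARD('d) + 3) * (CARD('d) + 4) ^ (CARD('d) - 1)
     * card (int_lattice \<inter> cball (0 :: real ^ 'd) 1)"

text \<open>
  The height is fixed at \<open>2 * sqrt d\<close> because the number of edges grows with it; the bound on the
  surface tension for larger \<open>H\<close> follows from monotonicity in \<open>H\<close>.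
\<close>

lemma card_edges_in_rect_le:
  fixes n x :: "real ^ 'd"
  assumes cube: "S \<in> unit_cubes n" "norm n = 1" and L: "2 * sqrt CARD('d) \<le> L"
  shows "card (edges_in (discretize (rect x L (2 * sqrt CARD('d)) S n)))
    \<le> edge_count_const TYPE('d) * L ^ (CARD('d) - 1)"
proof -
  let ?d = "real CARD('d)"
  let ?V = "discretize (rect x L (2 * sqrt ?d) S n)"
  let ?N = "card (int_lattice \<inter> cball (0 :: real ^ 'd) 1)"
  have "1 \<le> ?d"
    by (simp add: Suc_leI)
  then have "1 \<le> sqrt ?d"
    by simp
  then have "1 \<le> L" "0 \<le> L"
    using L by linarith+
  have fin: "finite ?V"
    using cube \<open>0 \<le> L\<close> by (rule finite_discretize_rect)
  have rect: "\<bar>(y - x) \<bullet> n\<bar> \<le> 2 * sqrt ?d" "norm (y - x) \<le> L * (?d / 2) + 2 * sqrt ?d" if "y \<in> ?V" for y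
    using rect_height_norm[OF cube \<open>0 \<le> L\<close>] that discretize_subset(2) by blast+
  have "real (card ?V) \<le> (2 * sqrt ?d * (2 * sqrt ?d) + 3) * (2 * (L * (?d / 2) + L) + 2) ^ (CARD('d) - 1)"
  proof (rule card_lattice_slab_le[OF \<open>norm n = 1\<close>])
    show "\<bar>(y - x) $ i\<bar> \<le> L * (?d / 2) + L" if "y \<in> ?V" for y i
      using component_le_norm_cart[of "y - x" i] rect(2)[OF that] L by linarith
  qed (use fin rect(1) discretize_subset(1) \<open>0 \<le> L\<close> in auto)
  also have "\<dots> \<le> (4 * ?d + 3) * ((?d + 4) * L) ^ (CARD('d) - 1)"
    using \<open>1 \<le> L\<close> by (intro mult_mono power_mono) (auto simp: algebra_simps)
  finally have V: "real (card ?V) \<le> (4 * ?d + 3) * (?d + 4) ^ (CARD('d) - 1) * L ^ (CARD('d) - 1)"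
    by (simp add: power_mult_distrib)
  have "real (card (edges_in ?V)) \<le> real (card ?V * ?N)"
    using card_edges_in_le[OF fin discretize_subset(1)] by (rule of_nat_mono)
  also have "\<dots> \<le> (4 * ?d + 3) * (?d + 4) ^ (CARD('d) - 1) * L ^ (CARD('d) - 1) * ?N"
    using V by (simp add: mult_right_mono)
  finally show ?thesis
    by (simp add: edge_count_const_def algebra_simps)
qed

section \<open>The essential range of the couplings\<close>

context
  fixes \<mu> :: "real measure"
  assumes law: "coupling_law \<mu>"
begin

lemma coupling_law_events: "{j \<in> space \<mu>. j < l} \<in> sets \<mu>" "{j \<in> space \<mu>. j > l} \<in> sets \<mu>"
proof -
  have "sets \<mu> = sets borel"
    using law by (simp add: coupling_law_def)
  moreover from this have "space \<mu> = UNIV"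
    using sets_eq_imp_space_eq by fastforce
  moreover have "{..<l} \<in> sets borel" "{l<..} \<in> sets borel"
    by simp_all
  ultimately show "{j \<in> space \<mu>. j < l} \<in> sets \<mu>" "{j \<in> space \<mu>. j > l} \<in> sets \<mu>"
    by (simp_all add: lessThan_def greaterThan_def)
qed

lemma J_min_nonneg: "0 \<le> J_min \<mu>"
proof -
  interpret prob_space \<mu>
    using law by (simp add: coupling_law_def)
  have "AE j in \<mu>. j \<in> {0..1}"
    using law by (simp add: coupling_law_def)
  then have "AE j in \<mu>. j < 2"
    by eventually_elim auto
  then have "prob {j \<in> space \<mu>. j < 2} = 1"
    using prob_Collect_eq_1[OF coupling_law_events(1)] by blast
  then have "{l. 0 \<le> l \<and> prob {j \<in> space \<mu>. j < l} > 0} \<noteq> {}"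
    by (intro ex_in_conv[THEN iffD1] exI[of _ 2]) simp
  then show ?thesis
    unfolding J_min_def by (rule cInf_greatest) simp
qed

text \<open>
  Every \<open>l < J_min\<close> bounds the couplings from below almost surely, and countably many such \<open>l\<close> approach
  \<open>J_min\<close>. The upper bound below is the same argument.
\<close>

lemma AE_J_min_le: "AE j in \<mu>. J_min \<mu> \<le> j"
proof -
  interpret prob_space \<mu>
    using law by (simp add: coupling_law_def)
  have ge: "AE j in \<mu>. l \<le> j" if "l < J_min \<mu>" for l
  proof (cases "0 \<le> l")
    case True
    have "l \<notin> {l. 0 \<le> l \<and> prob {j \<in> space \<mu>. j < l} > 0}"
    proof
      assume "l \<in> {l. 0 \<le> l \<and> prob {j \<in> space \<mu>. j < l} > 0}"
      then have "J_min \<mu> \<le> l"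
        unfolding J_min_def by (rule cInf_lower) (auto intro: bdd_belowI[of _ 0])
      then show False
        using that by simp
    qed
    then have "prob {j \<in> space \<mu>. j < l} = 0"
      using True by (simp add: zero_less_measure_iff)
    then have "AE j in \<mu>. j \<notin> {j \<in> space \<mu>. j < l}"
      using prob_eq_0[OF coupling_law_events(1)] by blast
    then show ?thesis
      using AE_space by eventually_elim auto
  next
    case False
    have "AE j in \<mu>. j \<in> {0..1}"
      using law by (simp add: coupling_law_def)
    then show ?thesis
      by eventually_elim (use False in auto)
  qed
  have "AE j in \<mu>. \<forall>k. J_min \<mu> - inverse (real (Suc k)) \<le> j"
    unfolding AE_all_countable using ge by (auto simp: inverse_eq_divide)
  then show ?thesis
  proof eventually_elim
    case (elim j)
    show ?case
    proof (rule ccontr)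
      assume "\<not> J_min \<mu> \<le> j"
      then obtain k where "inverse (real (Suc k)) < J_min \<mu> - j"
        using reals_Archimedean[of "J_min \<mu> - j"] by auto
      then show False
        using elim[rule_format, of k] by linarith
    qed
  qed
qed

lemma AE_le_J_max: "AE j in \<mu>. j \<le> J_max \<mu>" and J_max_nonneg: "0 \<le> J_max \<mu>"
proof -
  interpret prob_space \<mu>
    using law by (simp add: coupling_law_def)
  let ?A = "insert 0 {l. 0 \<le> l \<and> prob {j \<in> space \<mu>. j > l} > 0}"
  have bdd: "bdd_above ?A"
  proof (rule bdd_aboveI[of _ 1])
    fix l
    assume l: "l \<in> ?A"
    show "l \<le> 1"
    proof (rule ccontr)
      assume "\<not> l \<le> 1"
      have "AE j in \<mu>. j \<in> {0..1}"
        using law by (simp add: coupling_law_def)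
      then have "AE j in \<mu>. j \<notin> {j \<in> space \<mu>. j > l}"
        by eventually_elim (use \<open>\<not> l \<le> 1\<close> in auto)
      then have "prob {j \<in> space \<mu>. j > l} = 0"
        using prob_eq_0[OF coupling_law_events(2)] by blast
      then show False
        using l \<open>\<not> l \<le> 1\<close> by auto
    qed
  qed
  show nonneg: "0 \<le> J_max \<mu>"
    unfolding J_max_def using bdd by (intro cSup_upper) auto
  have le: "AE j in \<mu>. j \<le> l" if "J_max \<mu> < l" for l
  proof -
    have "l \<notin> ?A"
    proof
      assume "l \<in> ?A"
      then have "l \<le> J_max \<mu>"
        unfolding J_max_def using bdd by (rule cSup_upper)
      then show False
        using that by simp
    qed
    then have "prob {j \<in> space \<mu>. j > l} = 0"
      using nonneg that by (simp add: zero_less_measure_iff)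
    then have "AE j in \<mu>. j \<notin> {j \<in> space \<mu>. j > l}"
      using prob_eq_0[OF coupling_law_events(2)] by blast
    then show ?thesis
      using AE_space by eventually_elim auto
  qed
  have "AE j in \<mu>. \<forall>k. j \<le> J_max \<mu> + inverse (real (Suc k))"
    unfolding AE_all_countable using le by (auto simp: inverse_eq_divide)
  then show "AE j in \<mu>. j \<le> J_max \<mu>"
  proof eventually_elim
    case (elim j)
    show ?case
    proof (rule ccontr)
      assume "\<not> j \<le> J_max \<mu>"
      then obtain k where "inverse (real (Suc k)) < j - J_max \<mu>"
        using reals_Archimedean[of "j - J_max \<mu>"] by auto
      then show False
        using elim[rule_format, of k] by linarith
    qed
  qed
qed

lemma AE_coupling_bounds:
  "AE J in (coupling_measure \<mu> :: ((real ^ 'd) set \<Rightarrow> real) measure).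
     \<forall>e\<in>lattice_edges. J_min \<mu> \<le> J e \<and> J e \<le> J_max \<mu>"
proof -
  have "countable (range (\<lambda>f :: 'd \<Rightarrow> int. \<chi> i. real_of_int (f i)))"
    by simp
  moreover have "int_lattice \<subseteq> range (\<lambda>f :: 'd \<Rightarrow> int. \<chi> i. real_of_int (f i))"
  proof
    fix y :: "real ^ 'd"
    assume "y \<in> int_lattice"
    then have "y = (\<chi> i. real_of_int \<lfloor>y $ i\<rfloor>)"
      by (simp add: vec_eq_iff int_lattice_def)
    then show "y \<in> range (\<lambda>f :: 'd \<Rightarrow> int. \<chi> i. real_of_int (f i))"
      by (rule range_eqI[of _ _ "\<lambda>i. \<lfloor>y $ i\<rfloor>"])
  qed
  ultimately have "countable (int_lattice :: (real ^ 'd) set)"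
    by (rule countable_subset[rotated])
  then have "countable ((\<lambda>(x, y). {x, y}) ` (int_lattice \<times> (int_lattice :: (real ^ 'd) set)))"
    by (intro countable_image countable_SIGMA)
  then have "countable (lattice_edges :: (real ^ 'd) set set)"
    by (rule countable_subset[rotated]) (auto simp: edges_in_def)
  moreover have "AE J in coupling_measure \<mu>. J_min \<mu> \<le> J e \<and> J e \<le> J_max \<mu>"
    if "e \<in> lattice_edges" for e :: "(real ^ 'd) set"
    unfolding coupling_measure_def
    using law that AE_J_min_le AE_le_J_max
    by (intro AE_PiM_component) (auto simp: coupling_law_def)
  ultimately show ?thesis
    by (simp add: AE_ball_countable)
qed

end

theorem proposition1p2:
  assumes "CARD('d::finite) \<ge> 2"
  shows "\<exists>c_d :: real. \<forall>(q::real) (x :: real ^ 'd) (n :: real ^ 'd) S L.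
    q \<ge> 1 \<longrightarrow> norm n = 1 \<longrightarrow> S \<in> unit_cubes n \<longrightarrow> L \<ge> 2 * sqrt (real CARD('d)) \<longrightarrow>
      (\<forall>\<beta> H. \<beta> \<ge> 0 \<longrightarrow> H \<ge> 2 * sqrt (real CARD('d)) \<longrightarrow>
         mono_on (\<Pi>\<^sub>E e\<in>lattice_edges. {0..1}) (\<lambda>J. surface_tension q \<beta> J x L H S n))
    \<and> (\<forall>J H. J \<in> (\<Pi>\<^sub>E e\<in>lattice_edges. {0..1}) \<longrightarrow> H \<ge> 2 * sqrt (real CARD('d)) \<longrightarrow>
         mono_on {0..} (\<lambda>\<beta>. surface_tension q \<beta> J x L H S n))
    \<and> (\<forall>J \<beta>. J \<in> (\<Pi>\<^sub>E e\<in>lattice_edges. {0..1}) \<longrightarrow> \<beta> \<ge> 0 \<longrightarrow>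
         antimono_on {2 * sqrt (real CARD('d))..} (\<lambda>H. surface_tension q \<beta> J x L H S n))
    \<and> (\<forall>\<mu> \<beta> H. coupling_law \<mu> \<longrightarrow> \<beta> \<ge> 0 \<longrightarrow> H \<ge> 2 * sqrt (real CARD('d)) \<longrightarrow>
         (AE J in coupling_measure \<mu>.
            0 \<le> surface_tension q \<beta> (\<lambda>_. J_min \<mu>) x L H S n
          \<and> surface_tension q \<beta> (\<lambda>_. J_min \<mu>) x L H S n \<le> surface_tension q \<beta> J x L H S n
          \<and> surface_tension q \<beta> J x L H S n \<le> surface_tension q \<beta> (\<lambda>_. J_max \<mu>) x L H S n
          \<and> surface_tension q \<beta> (\<lambda>_. J_max \<mu>) x L H S n \<le> c_d * \<beta> * J_max \<mu>))"
proof (rule exI[of _ "edge_count_const TYPE('d)"], intro allI impI)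
  fix q :: real and x n :: "real ^ 'd" and S :: "(real ^ 'd) set" and L :: real
  let ?H0 = "2 * sqrt (real CARD('d))"
  let ?\<tau> = "\<lambda>\<beta> J H. surface_tension q \<beta> J x L H S n"
  assume q: "q \<ge> 1" and n: "norm n = 1" and S: "S \<in> unit_cubes n" and L: "L \<ge> ?H0"
  have "1 \<le> sqrt (real CARD('d))"
    using assms by simp
  then have H0: "1 < ?H0" and "0 < L"
    using L by linarith+
  note cube = S n less_imp_le[OF \<open>0 < L\<close>] q
  note mono = surface_tension_mono[OF cube]
  note antimono = surface_tension_antimono_height[OF cube]
  have "mono_on (\<Pi>\<^sub>E e\<in>lattice_edges. {0..1}) (\<lambda>J. ?\<tau> \<beta> J H)" if "\<beta> \<ge> 0" for \<beta> H
  proof (rule mono_onI)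
    fix J J' :: "(real ^ 'd) set \<Rightarrow> real"
    assume "J \<in> (\<Pi>\<^sub>E e\<in>lattice_edges. {0..1})" "J' \<in> (\<Pi>\<^sub>E e\<in>lattice_edges. {0..1})" "J \<le> J'"
    then show "?\<tau> \<beta> J H \<le> ?\<tau> \<beta> J' H"
      using \<open>\<beta> \<ge> 0\<close> by (intro mono mult_left_mono mult_nonneg_nonneg) (auto simp: le_fun_def PiE_iff)
  qed
  moreover have "mono_on {0..} (\<lambda>\<beta>. ?\<tau> \<beta> J H)" if "J \<in> (\<Pi>\<^sub>E e\<in>lattice_edges. {0..1})" for J H
    using that by (intro mono_onI mono mult_right_mono mult_nonneg_nonneg) (auto simp: PiE_iff)
  moreover have "antimono_on {?H0..} (\<lambda>H. ?\<tau> \<beta> J H)"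
    if "J \<in> (\<Pi>\<^sub>E e\<in>lattice_edges. {0..1})" "\<beta> \<ge> 0" for J \<beta>
  proof (rule monotone_onI)
    fix H H'
    assume "H \<in> {?H0..}" "H \<le> H'"
    then show "?\<tau> \<beta> J H' \<le> ?\<tau> \<beta> J H"
      using that H0 by (intro antimono) (auto simp: PiE_iff)
  qed
  moreover have "AE J in coupling_measure \<mu>.
       0 \<le> ?\<tau> \<beta> (\<lambda>_. J_min \<mu>) H \<and> ?\<tau> \<beta> (\<lambda>_. J_min \<mu>) H \<le> ?\<tau> \<beta> J H
     \<and> ?\<tau> \<beta> J H \<le> ?\<tau> \<beta> (\<lambda>_. J_max \<mu>) H
     \<and> ?\<tau> \<beta> (\<lambda>_. J_max \<mu>) H \<le> edge_count_const TYPE('d) * \<beta> * J_max \<mu>"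
    if law: "coupling_law \<mu>" and "\<beta> \<ge> 0" and H: "H \<ge> ?H0" for \<mu> \<beta> H
    using AE_coupling_bounds[OF law]
  proof eventually_elim
    case (elim J)
    have lower: "0 \<le> \<beta> * J_min \<mu>" and upper: "0 \<le> \<beta> * J_max \<mu>"
      using J_min_nonneg[OF law] J_max_nonneg[OF law] \<open>\<beta> \<ge> 0\<close> by simp_all
    have "?\<tau> \<beta> (\<lambda>_. J_max \<mu>) H \<le> ?\<tau> \<beta> (\<lambda>_. J_max \<mu>) ?H0"
      using upper H H0 by (intro antimono)
    also have "\<dots> \<le> \<beta> * J_max \<mu> * card (edges_in (discretize (rect x L ?H0 S n))) / L ^ (CARD('d) - 1)"
      using upper by (rule surface_tension_const_le[OF cube])
    also have "\<dots> \<le> \<beta> * J_max \<mu> * (edge_count_const TYPE('d) * L ^ (CARD('d) - 1)) / L ^ (CARD('d) - 1)"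
      using card_edges_in_rect_le[OF S n L, of x] upper \<open>0 < L\<close>
      by (intro divide_right_mono mult_left_mono) auto
    also have "\<dots> = edge_count_const TYPE('d) * \<beta> * J_max \<mu>"
      using \<open>0 < L\<close> by simp
    finally have "?\<tau> \<beta> (\<lambda>_. J_max \<mu>) H \<le> edge_count_const TYPE('d) * \<beta> * J_max \<mu>" .
    moreover have "0 \<le> ?\<tau> \<beta> (\<lambda>_. J_min \<mu>) H"
      using lower by (rule surface_tension_nonneg[OF cube])
    moreover have "?\<tau> \<beta> (\<lambda>_. J_min \<mu>) H \<le> ?\<tau> \<beta> J H"
      using elim lower \<open>\<beta> \<ge> 0\<close> by (intro mono mult_left_mono) auto
    moreover have "?\<tau> \<beta> J H \<le> ?\<tau> \<beta> (\<lambda>_. J_max \<mu>) H"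
    proof (rule mono)
      fix e :: "(real ^ 'd) set"
      assume "e \<in> lattice_edges"
      then have e: "J_min \<mu> \<le> J e" "J e \<le> J_max \<mu>"
        using elim by auto
      then have "0 \<le> J e"
        using J_min_nonneg[OF law] by linarith
      then show "0 \<le> \<beta> * J e" "\<beta> * J e \<le> \<beta> * J_max \<mu>"
        using e \<open>\<beta> \<ge> 0\<close> by (auto intro: mult_left_mono)
    qed
    ultimately show ?case
      by blast
  qed
  ultimately show "(\<forall>\<beta> H. \<beta> \<ge> 0 \<longrightarrow> H \<ge> ?H0 \<longrightarrow> mono_on (\<Pi>\<^sub>E e\<in>lattice_edges. {0..1}) (\<lambda>J. ?\<tau> \<beta> J H))
    \<and> (\<forall>J H. J \<in> (\<Pi>\<^sub>E e\<in>lattice_edges. {0..1}) \<longrightarrow> H \<ge> ?H0 \<longrightarrow> mono_on {0..} (\<lambda>\<beta>. ?\<tau> \<beta> J H))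
    \<and> (\<forall>J \<beta>. J \<in> (\<Pi>\<^sub>E e\<in>lattice_edges. {0..1}) \<longrightarrow> \<beta> \<ge> 0 \<longrightarrow> antimono_on {?H0..} (\<lambda>H. ?\<tau> \<beta> J H))
    \<and> (\<forall>\<mu> \<beta> H. coupling_law \<mu> \<longrightarrow> \<beta> \<ge> 0 \<longrightarrow> H \<ge> ?H0 \<longrightarrow>
         (AE J in coupling_measure \<mu>.
            0 \<le> ?\<tau> \<beta> (\<lambda>_. J_min \<mu>) H \<and> ?\<tau> \<beta> (\<lambda>_. J_min \<mu>) H \<le> ?\<tau> \<beta> J H
          \<and> ?\<tau> \<beta> J H \<le> ?\<tau> \<beta> (\<lambda>_. J_max \<mu>) H
          \<and> ?\<tau> \<beta> (\<lambda>_. J_max \<mu>) H \<le> edge_count_const TYPE('d) * \<beta> * J_max \<mu>))"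
    by blast
qed

end
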